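(* Let $G=\mathbb{Z}_{m_1}\times\cdots\times\mathbb{Z}_{m_n}$ be a finite abelian group with $m_i\mid m_{i+1}$ for $1\le i\le n-1$, let $(B_\bullet,\partial_\bullet)$ be its normalized bar resolution and $(K_\bullet,d_\bullet)$ the Koszul-like resolution defined in the context. Let $F_0:B_0=\mathbb{Z}G\to K_0=\mathbb{Z}G$ be the identity, and for $k\ge 1$ let $F_k:B_k\to K_k$ be the $\mathbb{Z}G$-linear map $$F_k([g^{\alpha_1},\dots,g^{\alpha_k}])=\sum_{l=1}^{k}\ \sum_{\substack{1\le r_1<\cdots<r_l\le n\\ \lambda_1+\cdots+\lambda_l=k,\ \lambda_i\ge1}}(-1)^{\sum_{1\le i<j\le l}\lambda_i\lambda_j}\,\xi^{\alpha}_{r_1,[a_1,b_1]}\cdots\xi^{\alpha}_{r_l,[a_l,b_l]}\,\Phi_{r_1^{\lambda_1}\cdots r_l^{\lambda_l}},$$ where $a_u=\sum_{i=u+1}^l\lambda_i+1$ and $b_u=\sum_{i=u}^l\lambda_i$ for $1\le u\le l$. Then $F_\bullet$ is a chain map from $(B_\bullet,\partial_\bullet)$ to $(K_\bullet,d_\bullet)$ lifting the identity of $\mathbb{Z}$, i.e. $d\circ F_k=F_{k-1}\circ\partial_k$ for all $k\ge1$, and $F_0$ is compatible with the augmentations to $\mathbb{Z}$.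
   Context: For each $i$ fix a generator $g_i$ of the factor $\mathbb{Z}_{m_i}$ (written multiplicatively), and put $T_i=g_i-1$, $N_i=\sum_{j=0}^{m_i-1}g_i^j$ and $(g_i)_r=\sum_{j=0}^{r-1}g_i^j$ in $\mathbb{Z}G$ (so $(g_i)_0=0$). $[\frac{s}{r}]$ denotes the integer part of $\frac{s}{r}$. Normalized bar resolution: $B_0=\mathbb{Z}G[\;]$ with augmentation $[\;]\mapsto 1$; for $k\ge1$, $B_k$ is the free $\mathbb{Z}G$-module on symbols $[h_1,\dots,h_k]$, $h_i\in G\setminus\{1\}$, with the convention that $[h_1,\dots,h_k]=0$ if some $h_i=1$; and $\partial_k[h_1,\dots,h_k]=h_1[h_2,\dots,h_k]+\sum_{u=1}^{k-1}(-1)^u[h_1,\dots,h_uh_{u+1},\dots,h_k]+(-1)^k[h_1,\dots,h_{k-1}]$. Koszul-like resolution: for nonnegative integers $a_1,\dots,a_n$ let $\Phi(a_1,\dots,a_n)$ be a free generator in degree $a_1+\cdots+a_n$, and $K_m=\bigoplus_{a_1+\cdots+a_n=m}(\mathbb{Z}G)\Phi(a_1,\dots,a_n)$. The differential is $d=d_1+\cdots+d_n$, where $d_i(\Phi(a_1,\dots,a_n))$ equals $0$ if $a_i=0$; $(-1)^{\sum_{l<i}a_l}N_i\Phi(a_1,\dots,a_i-1,\dots,a_n)$ if $a_i\ne0$ is even; $(-1)^{\sum_{l<i}a_l}T_i\Phi(a_1,\dots,a_i-1,\dots,a_n)$ if $a_i$ is odd. $K_0=\mathbb{Z}G\,\Phi(0,\dots,0)\cong\mathbb{Z}G$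 with the usual augmentation to $\mathbb{Z}$. For $1\le r_1<\cdots<r_l\le n$, $\lambda_i\ge1$, $\Phi_{r_1^{\lambda_1}\cdots r_l^{\lambda_l}}$ is $\Phi(0,\dots,\lambda_1,\dots,\lambda_l,\dots,0)$ with $\lambda_i$ in position $r_i$ and zeros elsewhere. Notation $\xi$: let $\alpha=(\alpha_1,\dots,\alpha_k)$ with $\alpha_u=(\alpha_{u1},\dots,\alpha_{un})$, $0\le\alpha_{uj}<m_j$ integers, and $g^{\alpha_u}=g_1^{\alpha_{u1}}\cdots g_n^{\alpha_{un}}$. For $1\le r\le n$ and integers $1\le a\le b\le k$, if $b-a$ is odd set $$\xi^{\alpha}_{r,[a,b]}=\left[\tfrac{\alpha_{br}+\alpha_{b-1,r}}{m_r}\right]\left[\tfrac{\alpha_{b-2,r}+\alpha_{b-3,r}}{m_r}\right]\cdots\left[\tfrac{\alpha_{a+1,r}+\alpha_{ar}}{m_r}\right]g_1^{\alpha_{b1}+\cdots+\alpha_{a1}}\cdots g_{r-1}^{\alpha_{b,r-1}+\cdots+\alpha_{a,r-1}},$$ and if $b-a$ is even set $$\xi^{\alpha}_{r,[a,b]}=\left[\tfrac{\alpha_{br}+\alpha_{b-1,r}}{m_r}\right]\cdots\left[\tfrac{\alpha_{a+2,r}+\alpha_{a+1,r}}{m_r}\right]g_1^{\alpha_{b1}+\cdots+\alpha_{a1}}\cdots g_{r-1}^{\alpha_{b,r-1}+\cdots+\alpha_{a,r-1}}(g_r)_{\alpha_{ar}}$$ (products of integer parts over consecutive disjoint pairs of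 indices; an empty product is $1$). In $g_j^{\alpha_{bj}+\cdots+\alpha_{aj}}$ the exponent is $\sum_{u=a}^b\alpha_{uj}$. *)

theory Defs
  imports "HOL-Algebra.Algebra" "HOL-Library.Poly_Mapping"
begin

section \<open>Integral group ring and free modules over it\<close>

text \<open>
  Elements of the integral group ring are finitely supported functions with integer values whose
  support lies in the carrier of the group; zero and addition of the ring (and of the
  free modules below) are the pointwise ones of the type, so \<open>+\<close>, \<open>-\<close> and \<open>\<Sum>\<close> can be used directly.
\<close>

definition group_ring :: "('g, 'b) monoid_scheme \<Rightarrow> ('g \<Rightarrow>\<^sub>0 int) ring" where
  "group_ring G =
    \<lparr>carrier = {x. Poly_Mapping.keys x \<subseteq> carrier G},
     monoid.mult = (\<lambda>x y. \<Sum>a\<in>Poly_Mapping.keys x. \<Sum>b\<in>Poly_Mapping.keys y.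
        Poly_Mapping.single (a \<otimes>\<^bsub>G\<^esub> b) (Poly_Mapping.lookup x a * Poly_Mapping.lookup y b)),
     one = Poly_Mapping.single \<one>\<^bsub>G\<^esub> 1,
     ring.zero = 0,
     ring.add = (+)\<rparr>"

definition gr_elem :: "'g \<Rightarrow> ('g \<Rightarrow>\<^sub>0 int)" where
  "gr_elem h = Poly_Mapping.single h 1"

definition gr_int :: "('g, 'b) monoid_scheme \<Rightarrow> int \<Rightarrow> ('g \<Rightarrow>\<^sub>0 int)" where
  "gr_int G c = Poly_Mapping.single \<one>\<^bsub>G\<^esub> c"

definition gr_augmentation :: "('g \<Rightarrow>\<^sub>0 int) \<Rightarrow> int" where
  "gr_augmentation x = (\<Sum>a\<in>Poly_Mapping.keys x. Poly_Mapping.lookup x a)"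

text \<open>The library's module record extends rings; \<open>mult\<close> and \<open>one\<close> are irrelevant for modules.\<close>

definition free_gr_module ::
    "('g, 'b) monoid_scheme \<Rightarrow> 's set \<Rightarrow> ('g \<Rightarrow>\<^sub>0 int, 's \<Rightarrow>\<^sub>0 ('g \<Rightarrow>\<^sub>0 int)) module" where
  "free_gr_module G S =
    \<lparr>carrier = {v. Poly_Mapping.keys v \<subseteq> S \<and>
                   (\<forall>s. Poly_Mapping.lookup v s \<in> carrier (group_ring G))},
     monoid.mult = undefined,
     one = undefined,
     ring.zero = 0,
     ring.add = (+),
     smult = (\<lambda>r v. Poly_Mapping.map (\<lambda>x. r \<otimes>\<^bsub>group_ring G\<^esub> x) v)\<rparr>"

abbreviation gr_smult ::
    "('g, 'b) monoid_scheme \<Rightarrow> ('g \<Rightarrow>\<^sub>0 int) \<Rightarrow> ('s \<Rightarrow>\<^sub>0 ('g \<Rightarrow>\<^sub>0 int)) \<Rightarrow> ('s \<Rightarrow>\<^sub>0 ('g \<Rightarrow>\<^sub>0 int))" where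
  "gr_smult G r v \<equiv> r \<odot>\<^bsub>free_gr_module G UNIV\<^esub> v"

definition gen :: "('g, 'b) monoid_scheme \<Rightarrow> 's \<Rightarrow> ('s \<Rightarrow>\<^sub>0 ('g \<Rightarrow>\<^sub>0 int))" where
  "gen G s = Poly_Mapping.single s \<one>\<^bsub>group_ring G\<^esub>"

definition linear_extension ::
    "('g, 'b) monoid_scheme \<Rightarrow> ('s \<Rightarrow> ('t \<Rightarrow>\<^sub>0 ('g \<Rightarrow>\<^sub>0 int))) \<Rightarrow>
      ('s \<Rightarrow>\<^sub>0 ('g \<Rightarrow>\<^sub>0 int)) \<Rightarrow> ('t \<Rightarrow>\<^sub>0 ('g \<Rightarrow>\<^sub>0 int))" where
  "linear_extension G f v =
    (\<Sum>s\<in>Poly_Mapping.keys v. gr_smult G (Poly_Mapping.lookup v s) (f s))"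

definition module_homs ::
    "('r, 'a) ring_scheme \<Rightarrow> ('r, 'x, 'b) module_scheme \<Rightarrow> ('r, 'y, 'c) module_scheme \<Rightarrow> ('x \<Rightarrow> 'y) set"
  where
  "module_homs R M N =
    {f \<in> carrier M \<rightarrow> carrier N.
      (\<forall>x\<in>carrier M. \<forall>y\<in>carrier M. f (x \<oplus>\<^bsub>M\<^esub> y) = f x \<oplus>\<^bsub>N\<^esub> f y) \<and>
      (\<forall>r\<in>carrier R. \<forall>x\<in>carrier M. f (r \<odot>\<^bsub>M\<^esub> x) = r \<odot>\<^bsub>N\<^esub> f x)}"

definition chain_map ::
    "('r, 'a) ring_scheme \<Rightarrow>
      (nat \<Rightarrow> ('r, 'x, 'b) module_scheme) \<Rightarrow> (nat \<Rightarrow> 'x \<Rightarrow> 'x) \<Rightarrow>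
      (nat \<Rightarrow> ('r, 'y, 'c) module_scheme) \<Rightarrow> (nat \<Rightarrow> 'y \<Rightarrow> 'y) \<Rightarrow>
      (nat \<Rightarrow> 'x \<Rightarrow> 'y) \<Rightarrow> bool" where
  "chain_map R C dC D dD f \<longleftrightarrow>
    (\<forall>k. f k \<in> module_homs R (C k) (D k)) \<and>
    (\<forall>k\<ge>1. \<forall>x\<in>carrier (C k). dD k (f k x) = f (k - 1) (dC k x))"


section \<open>Normalized bar resolution\<close>

definition bar_module ::
    "('g, 'b) monoid_scheme \<Rightarrow> nat \<Rightarrow> ('g \<Rightarrow>\<^sub>0 int, 'g list \<Rightarrow>\<^sub>0 ('g \<Rightarrow>\<^sub>0 int)) module" where
  "bar_module G k =
    free_gr_module G {hs. length hs = k \<and> set hs \<subseteq> carrier G - {\<one>\<^bsub>G\<^esub>}}"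

definition bar_symbol :: "('g, 'b) monoid_scheme \<Rightarrow> 'g list \<Rightarrow> ('g list \<Rightarrow>\<^sub>0 ('g \<Rightarrow>\<^sub>0 int))" where
  "bar_symbol G hs = (if \<one>\<^bsub>G\<^esub> \<in> set hs then 0 else gen G hs)"

text \<open>List positions start at 0, so \<open>h\<^sub>u\<close> is \<open>hs ! (u - 1)\<close>.\<close>

definition bar_diff ::
    "('g, 'b) monoid_scheme \<Rightarrow> nat \<Rightarrow> ('g list \<Rightarrow>\<^sub>0 ('g \<Rightarrow>\<^sub>0 int)) \<Rightarrow> ('g list \<Rightarrow>\<^sub>0 ('g \<Rightarrow>\<^sub>0 int))" where
  "bar_diff G k = linear_extension G (\<lambda>hs.
      gr_smult G (gr_elem (hs ! 0)) (bar_symbol G (tl hs))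
    + (\<Sum>u\<in>{1..k - 1}. gr_smult G (gr_int G ((-1) ^ u))
        (bar_symbol G (take (u - 1) hs @ (hs ! (u - 1) \<otimes>\<^bsub>G\<^esub> hs ! u) # drop (u + 1) hs)))
    + gr_smult G (gr_int G ((-1) ^ k)) (bar_symbol G (butlast hs)))"

definition bar_augmentation :: "('g list \<Rightarrow>\<^sub>0 ('g \<Rightarrow>\<^sub>0 int)) \<Rightarrow> int" where
  "bar_augmentation v = gr_augmentation (Poly_Mapping.lookup v [])"


section \<open>Koszul-like resolution\<close>

text \<open>
  Below, \<open>G\<close> is the internal direct product of cyclic subgroups of order \<open>m i\<close> generated by
  \<open>g i\<close>, for \<open>i \<in> {1..n}\<close>. The index \<open>(a\<^sub>1, \<dots>, a\<^sub>n)\<close> of a generator \<open>\<Phi>\<close> is a function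
  vanishing outside \<open>{1..n}\<close>.
\<close>

definition koszul_module ::
    "('g, 'b) monoid_scheme \<Rightarrow> nat \<Rightarrow> nat \<Rightarrow>
      ('g \<Rightarrow>\<^sub>0 int, (nat \<Rightarrow> nat) \<Rightarrow>\<^sub>0 ('g \<Rightarrow>\<^sub>0 int)) module" where
  "koszul_module G n k =
    free_gr_module G {a. (\<forall>i. i \<notin> {1..n} \<longrightarrow> a i = 0) \<and> (\<Sum>i\<in>{1..n}. a i) = k}"

definition gr_T :: "('g, 'b) monoid_scheme \<Rightarrow> (nat \<Rightarrow> 'g) \<Rightarrow> nat \<Rightarrow> ('g \<Rightarrow>\<^sub>0 int)" where
  "gr_T G g i = gr_elem (g i) - \<one>\<^bsub>group_ring G\<^esub>"

text \<open>\<open>gr_partial G g i r\<close> is \<open>(g\<^sub>i)\<^sub>r\<close>.\<close>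

definition gr_partial :: "('g, 'b) monoid_scheme \<Rightarrow> (nat \<Rightarrow> 'g) \<Rightarrow> nat \<Rightarrow> nat \<Rightarrow> ('g \<Rightarrow>\<^sub>0 int)" where
  "gr_partial G g i r = (\<Sum>j<r. gr_elem (g i [^]\<^bsub>G\<^esub> j))"

definition gr_N :: "('g, 'b) monoid_scheme \<Rightarrow> (nat \<Rightarrow> 'g) \<Rightarrow> (nat \<Rightarrow> nat) \<Rightarrow> nat \<Rightarrow> ('g \<Rightarrow>\<^sub>0 int)" where
  "gr_N G g m i = (\<Sum>j<m i. gr_elem (g i [^]\<^bsub>G\<^esub> j))"

definition koszul_diff_part ::
    "('g, 'b) monoid_scheme \<Rightarrow> (nat \<Rightarrow> 'g) \<Rightarrow> (nat \<Rightarrow> nat) \<Rightarrow> nat \<Rightarrow>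
      (nat \<Rightarrow> nat) \<Rightarrow> ((nat \<Rightarrow> nat) \<Rightarrow>\<^sub>0 ('g \<Rightarrow>\<^sub>0 int))" where
  "koszul_diff_part G g m i a =
    (if a i = 0 then 0
     else gr_smult G
       (gr_int G ((-1) ^ (\<Sum>l\<in>{1..<i}. a l)) \<otimes>\<^bsub>group_ring G\<^esub>
         (if even (a i) then gr_N G g m i else gr_T G g i))
       (gen G (a(i := a i - 1))))"

definition koszul_diff ::
    "('g, 'b) monoid_scheme \<Rightarrow> (nat \<Rightarrow> 'g) \<Rightarrow> (nat \<Rightarrow> nat) \<Rightarrow> nat \<Rightarrow>
      ((nat \<Rightarrow> nat) \<Rightarrow>\<^sub>0 ('g \<Rightarrow>\<^sub>0 int)) \<Rightarrow> ((nat \<Rightarrow> nat) \<Rightarrow>\<^sub>0 ('g \<Rightarrow>\<^sub>0 int))" where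
  "koszul_diff G g m n = linear_extension G (\<lambda>a. \<Sum>i\<in>{1..n}. koszul_diff_part G g m i a)"

definition koszul_augmentation :: "((nat \<Rightarrow> nat) \<Rightarrow>\<^sub>0 ('g \<Rightarrow>\<^sub>0 int)) \<Rightarrow> int" where
  "koszul_augmentation v = gr_augmentation (Poly_Mapping.lookup v (\<lambda>_. 0))"


section \<open>The comparison map\<close>

text \<open>The exponents \<open>(\<alpha>\<^sub>1, \<dots>, \<alpha>\<^sub>n)\<close> with \<open>0 \<le> \<alpha>\<^sub>j < m\<^sub>j\<close> and \<open>h = g\<^sub>1\<^bsup>\<alpha>\<^sub>1\<^esup> \<cdots> g\<^sub>n\<^bsup>\<alpha>\<^sub>n\<^esup>\<close>.\<close>

definition exponents ::
    "('g, 'b) monoid_scheme \<Rightarrow> (nat \<Rightarrow> 'g) \<Rightarrow> (nat \<Rightarrow> nat) \<Rightarrow> nat \<Rightarrow> 'g \<Rightarrow> (nat \<Rightarrow> nat)" where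
  "exponents G g m n h =
    (THE e. e \<in> (\<Pi>\<^sub>E j\<in>{1..n}. {..<m j}) \<and> h = (\<Otimes>\<^bsub>G\<^esub>j\<in>{1..n}. g j [^]\<^bsub>G\<^esub> e j))"

text \<open>
  For both parities of \<open>b - a\<close> the pairs of indices in the product of integer parts are
  \<open>(b, b - 1), (b - 2, b - 3), \<dots>\<close>, and there are \<open>(b - a + 1) div 2\<close> of them; if \<open>b - a\<close> is even,
  the index \<open>a\<close> is left over and contributes a factor \<open>gr_partial G g r (\<alpha> a r)\<close>.
\<close>

definition xi ::
    "('g, 'b) monoid_scheme \<Rightarrow> (nat \<Rightarrow> 'g) \<Rightarrow> (nat \<Rightarrow> nat) \<Rightarrow>
      (nat \<Rightarrow> nat \<Rightarrow> nat) \<Rightarrow> nat \<Rightarrow> nat \<Rightarrow> nat \<Rightarrow> ('g \<Rightarrow>\<^sub>0 int)" where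
  "xi G g m \<alpha> r a b =
    gr_int G (int (\<Prod>t<(b - a + 1) div 2. (\<alpha> (b - 2 * t) r + \<alpha> (b - 2 * t - 1) r) div m r))
    \<otimes>\<^bsub>group_ring G\<^esub> gr_elem (\<Otimes>\<^bsub>G\<^esub>j\<in>{1..<r}. g j [^]\<^bsub>G\<^esub> (\<Sum>u\<in>{a..b}. \<alpha> u j))
    \<otimes>\<^bsub>group_ring G\<^esub> (if even (b - a) then gr_partial G g r (\<alpha> a r) else \<one>\<^bsub>group_ring G\<^esub>)"

definition increasing_tuples :: "nat \<Rightarrow> nat \<Rightarrow> (nat \<Rightarrow> nat) set" where
  "increasing_tuples l n = {r \<in> {1..l} \<rightarrow>\<^sub>E {1..n}. strict_mono_on {1..l} r}"

text \<open>
  Tuples \<open>\<lambda>\<^sub>1, \<dots>, \<lambda>\<^sub>l \<ge> 1\<close> with sum \<open>k\<close>; the bound \<open>\<lambda>\<^sub>i \<le> k\<close> is implied, and makes finiteness evident.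
\<close>

definition compositions :: "nat \<Rightarrow> nat \<Rightarrow> (nat \<Rightarrow> nat) set" where
  "compositions l k = {lam \<in> {1..l} \<rightarrow>\<^sub>E {1..k}. (\<Sum>i\<in>{1..l}. lam i) = k}"

text \<open>The index of \<open>\<Phi>\<close> with \<open>\<lambda>\<^sub>i\<close> in position \<open>r\<^sub>i\<close> and zeros elsewhere.\<close>

definition place :: "nat \<Rightarrow> (nat \<Rightarrow> nat) \<Rightarrow> (nat \<Rightarrow> nat) \<Rightarrow> (nat \<Rightarrow> nat)" where
  "place l r lam = (\<lambda>j. \<Sum>i\<in>{i \<in> {1..l}. r i = j}. lam i)"

definition comparison_value ::
    "('g, 'b) monoid_scheme \<Rightarrow> (nat \<Rightarrow> 'g) \<Rightarrow> (nat \<Rightarrow> nat) \<Rightarrow> nat \<Rightarrow> nat \<Rightarrow>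
      (nat \<Rightarrow> nat \<Rightarrow> nat) \<Rightarrow> ((nat \<Rightarrow> nat) \<Rightarrow>\<^sub>0 ('g \<Rightarrow>\<^sub>0 int))" where
  "comparison_value G g m n k \<alpha> =
    (\<Sum>l\<in>{1..k}. \<Sum>r\<in>increasing_tuples l n. \<Sum>lam\<in>compositions l k.
      gr_smult G
        (gr_int G ((-1) ^ (\<Sum>i\<in>{1..l}. \<Sum>j\<in>{i<..l}. lam i * lam j))
         \<otimes>\<^bsub>group_ring G\<^esub>
         (\<Otimes>\<^bsub>group_ring G\<^esub>u\<in>{1..l}.
            xi G g m \<alpha> (r u) ((\<Sum>i\<in>{u + 1..l}. lam i) + 1) (\<Sum>i\<in>{u..l}. lam i)))
        (gen G (place l r lam)))"

text \<open>In degree 0 the map is the identity of the group ring, \<open>[] \<mapsto> \<Phi>(0, \<dots>, 0)\<close>.\<close>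

definition comparison_map ::
    "('g, 'b) monoid_scheme \<Rightarrow> (nat \<Rightarrow> 'g) \<Rightarrow> (nat \<Rightarrow> nat) \<Rightarrow> nat \<Rightarrow> nat \<Rightarrow>
      ('g list \<Rightarrow>\<^sub>0 ('g \<Rightarrow>\<^sub>0 int)) \<Rightarrow> ((nat \<Rightarrow> nat) \<Rightarrow>\<^sub>0 ('g \<Rightarrow>\<^sub>0 int))" where
  "comparison_map G g m n k = linear_extension G (\<lambda>hs.
    if k = 0 then gen G (\<lambda>_. 0)
    else comparison_value G g m n k (\<lambda>u. exponents G g m n (hs ! (u - 1))))"


section \<open>Products of finite cyclic groups\<close>

definition cyclic_product :: "(nat \<Rightarrow> nat) \<Rightarrow> nat \<Rightarrow> (nat \<Rightarrow> int) monoid" where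
  "cyclic_product m n = product_group {1..n} (\<lambda>i. integer_mod_group (m i))"

definition factor_embedding :: "(nat \<Rightarrow> nat) \<Rightarrow> nat \<Rightarrow> nat \<Rightarrow> int \<Rightarrow> (nat \<Rightarrow> int)" where
  "factor_embedding m n i x =
    (\<lambda>j\<in>{1..n}. if j = i then x else \<one>\<^bsub>integer_mod_group (m j)\<^esub>)"

end

theory Submission
  imports Defs
begin

text \<open>
  The comparison map combines the Alexander-Whitney map with the classical comparison maps for cyclic groups. For a single cyclic group of order \<open>m\<close> with
  generator \<open>g\<close>, the map from the bar resolution to the periodic resolution (differentials \<open>T = g - 1\<close>
  and \<open>N\<close> in turn) sends a word of residues \<open>x\<^sub>1, \<dots>, x\<^sub>k\<close> to a product of the carries
  \<open>\<lfloor>(x + y) / m\<rfloor>\<close> of disjoint consecutive pairs, times \<open>(g)\<^bsub>x\<^sub>1\<^esub>\<close> if \<open>k\<close> is odd. It is a chain map for two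
  reasons: the carry is a 2-cocycle, hence so are its cup powers (\<open>carries_cocycle\<close>), and
  \<open>(g)\<^sub>x + g\<^sup>x (g)\<^sub>y - (g)\<^bsub>(x + y) mod m\<^esub>\<close> is the carry times \<open>N\<close> (\<open>gr_partial_carry\<close>). Together they give
  \<open>cyclic_coeff_boundary\<close>.

  For a product of cyclic groups, the Koszul-like resolution is the tensor product of the periodic ones. The
  formula of the theorem is the Alexander-Whitney map followed by the maps of the factors: a word is cut in two, the
  initial piece is mapped to the resolution of the last factor, the final piece to the resolution of the product of the
  other factors, translated by the projection of the product of the initial piece. The two tensor factors stand in the
  opposite order, and interchanging degrees \<open>p\<close> and \<open>q\<close> costs the sign \<open>(-1)\<^bsup>p q\<^esup>\<close>. Iterating over the
  factors accumulates the powers of \<open>g\<^sub>1, \<dots>, g\<^bsub>r - 1\<^esub>\<close> in \<open>\<xi>\<close> and the sign \<open>(-1)\<close> to the sum of the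
  \<open>\<lambda>\<^sub>i \<lambda>\<^sub>j\<close>.

  The proof works with coefficients instead of tensor products. The coefficient at a generator of the Koszul-like
  resolution is defined by recursion on the number of factors (\<open>comparison_coeff\<close>), and the chain map property
  becomes one identity in the group ring, proved by induction on the number of factors
  (\<open>comparison_coeff_boundary\<close>). It remains to match this recursion with the explicit formula. Its closed
  form is a product over all factors (\<open>comparison_coeff_closed_form\<close>), and the pairs \<open>(r, \<lambda>)\<close> correspond
  bijectively to the indices of generators, the \<open>r\<^sub>i\<close> being the support and the \<open>\<lambda>\<^sub>i\<close> the nonzero entries
  (\<open>place_inject\<close>, \<open>place_surj\<close>, \<open>comparison_term_coeff\<close>). The normalization of the bar
  resolution is respected because the coefficients vanish on words with an identity letter
  (\<open>comparison_coeff_zero\<close>).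
\<close>

section \<open>The integral group ring of an abelian group\<close>

lemma carrier_group_ring: "x \<in> carrier (group_ring G) \<longleftrightarrow> Poly_Mapping.keys x \<subseteq> carrier G"
  by (simp add: group_ring_def)

lemma group_ring_simps [simp]:
  "\<one>\<^bsub>group_ring G\<^esub> = Poly_Mapping.single \<one>\<^bsub>G\<^esub> 1" "\<zero>\<^bsub>group_ring G\<^esub> = 0" "x \<oplus>\<^bsub>group_ring G\<^esub> y = x + y"
  by (simp_all add: group_ring_def)

text \<open>
  The defining sum runs over the supports of the factors. Letting it run over any larger finite sets
  makes it additive in each factor, since a common superset of the supports can be used for a sum.
\<close>

lemma group_ring_mult_expand:
  assumes "finite A" "finite B" "Poly_Mapping.keys x \<subseteq> A" "Poly_Mapping.keys y \<subseteq> B"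
  shows "x \<otimes>\<^bsub>group_ring G\<^esub> y = (\<Sum>a\<in>A. \<Sum>b\<in>B.
    Poly_Mapping.single (a \<otimes>\<^bsub>G\<^esub> b) (Poly_Mapping.lookup x a * Poly_Mapping.lookup y b))"
proof -
  have "x \<otimes>\<^bsub>group_ring G\<^esub> y = (\<Sum>a\<in>Poly_Mapping.keys x. \<Sum>b\<in>Poly_Mapping.keys y.
        Poly_Mapping.single (a \<otimes>\<^bsub>G\<^esub> b) (Poly_Mapping.lookup x a * Poly_Mapping.lookup y b))"
    by (simp add: group_ring_def)
  also have "\<dots> = (\<Sum>a\<in>Poly_Mapping.keys x. \<Sum>b\<in>B.
        Poly_Mapping.single (a \<otimes>\<^bsub>G\<^esub> b) (Poly_Mapping.lookup x a * Poly_Mapping.lookup y b))"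
    using assms by (intro sum.cong sum.mono_neutral_left) (auto simp: in_keys_iff)
  also have "\<dots> = (\<Sum>a\<in>A. \<Sum>b\<in>B.
        Poly_Mapping.single (a \<otimes>\<^bsub>G\<^esub> b) (Poly_Mapping.lookup x a * Poly_Mapping.lookup y b))"
    using assms by (intro sum.mono_neutral_left) (auto simp: in_keys_iff)
  finally show ?thesis .
qed

lemma group_ring_distrib_right: "(x + y) \<otimes>\<^bsub>group_ring G\<^esub> z = x \<otimes>\<^bsub>group_ring G\<^esub> z + y \<otimes>\<^bsub>group_ring G\<^esub> z"
proof -
  let ?A = "Poly_Mapping.keys x \<union> Poly_Mapping.keys y" and ?B = "Poly_Mapping.keys z"
  have "Poly_Mapping.keys (x + y) \<subseteq> ?A" by (rule keys_add)
  then show ?thesis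
    by (simp add: group_ring_mult_expand[of ?A ?B] lookup_add distrib_right single_add sum.distrib)
qed

lemma group_ring_distrib_left: "z \<otimes>\<^bsub>group_ring G\<^esub> (x + y) = z \<otimes>\<^bsub>group_ring G\<^esub> x + z \<otimes>\<^bsub>group_ring G\<^esub> y"
proof -
  let ?A = "Poly_Mapping.keys x \<union> Poly_Mapping.keys y" and ?B = "Poly_Mapping.keys z"
  have "Poly_Mapping.keys (x + y) \<subseteq> ?A" by (rule keys_add)
  then show ?thesis
    by (simp add: group_ring_mult_expand[of ?B ?A] lookup_add distrib_left single_add sum.distrib)
qed

lemma group_ring_mult_zero [simp]:
  "0 \<otimes>\<^bsub>group_ring G\<^esub> x = 0" "x \<otimes>\<^bsub>group_ring G\<^esub> 0 = 0"
  by (simp_all add: group_ring_def)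

lemma group_ring_mult_uminus:
  "(- x) \<otimes>\<^bsub>group_ring G\<^esub> y = - (x \<otimes>\<^bsub>group_ring G\<^esub> y)" "x \<otimes>\<^bsub>group_ring G\<^esub> (- y) = - (x \<otimes>\<^bsub>group_ring G\<^esub> y)"
  using group_ring_distrib_right[where G = G and x = x and y = "- x" and z = y]
    group_ring_distrib_left[where G = G and x = y and y = "- y" and z = x]
  by (simp_all add: eq_neg_iff_add_eq_0 add.commute)

lemma group_ring_mult_diff:
  "(x - y) \<otimes>\<^bsub>group_ring G\<^esub> z = x \<otimes>\<^bsub>group_ring G\<^esub> z - y \<otimes>\<^bsub>group_ring G\<^esub> z"
  "z \<otimes>\<^bsub>group_ring G\<^esub> (x - y) = z \<otimes>\<^bsub>group_ring G\<^esub> x - z \<otimes>\<^bsub>group_ring G\<^esub> y"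
  using group_ring_distrib_right[where G = G and x = x and y = "- y" and z = z]
    group_ring_distrib_left[where G = G and x = x and y = "- y" and z = z]
  by (simp_all add: group_ring_mult_uminus)

lemma group_ring_mult_sum:
  "(\<Sum>i\<in>I. f i) \<otimes>\<^bsub>group_ring G\<^esub> y = (\<Sum>i\<in>I. f i \<otimes>\<^bsub>group_ring G\<^esub> y)"
  "y \<otimes>\<^bsub>group_ring G\<^esub> (\<Sum>i\<in>I. f i) = (\<Sum>i\<in>I. y \<otimes>\<^bsub>group_ring G\<^esub> f i)"
  by (induction I rule: infinite_finite_induct) (simp_all add: group_ring_distrib_right group_ring_distrib_left)

lemma group_ring_mult_single:
  "Poly_Mapping.single a c \<otimes>\<^bsub>group_ring G\<^esub> Poly_Mapping.single b d = Poly_Mapping.single (a \<otimes>\<^bsub>G\<^esub> b) (c * d)"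
  by (simp add: group_ring_mult_expand[of "{a}" "{b}"])

lemma group_ring_closed [simp]:
  "0 \<in> carrier (group_ring G)"
  "x \<in> carrier (group_ring G) \<Longrightarrow> y \<in> carrier (group_ring G) \<Longrightarrow> x + y \<in> carrier (group_ring G)"
  "x \<in> carrier (group_ring G) \<Longrightarrow> - x \<in> carrier (group_ring G)"
  "x \<in> carrier (group_ring G) \<Longrightarrow> y \<in> carrier (group_ring G) \<Longrightarrow> x - y \<in> carrier (group_ring G)"
  "h \<in> carrier G \<Longrightarrow> Poly_Mapping.single h c \<in> carrier (group_ring G)"
  "h \<in> carrier G \<Longrightarrow> gr_elem h \<in> carrier (group_ring G)"
  using keys_add[of x y] keys_diff[of x y] by (auto simp: carrier_group_ring gr_elem_def)

lemma group_ring_sum_closed [simp]: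
  "(\<And>i. i \<in> I \<Longrightarrow> f i \<in> carrier (group_ring G)) \<Longrightarrow> (\<Sum>i\<in>I. f i) \<in> carrier (group_ring G)"
  by (induction I rule: infinite_finite_induct) simp_all

lemma single_decomposition:
  "x = (\<Sum>a\<in>Poly_Mapping.keys x. Poly_Mapping.single a (Poly_Mapping.lookup x a))"
  by (rule poly_mapping_eqI) (auto simp: lookup_sum lookup_single when_def in_keys_iff)

text \<open>
  Additive identities in the ring need to be checked on multiples of group elements only.
\<close>

lemma group_ring_induct [consumes 1, case_names single zero add]:
  assumes "x \<in> carrier (group_ring G)"
    and "\<And>h c. h \<in> carrier G \<Longrightarrow> P (Poly_Mapping.single h c)"
    and "P 0"
    and "\<And>x y. P x \<Longrightarrow> P y \<Longrightarrow> P (x + y)"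
  shows "P x"
proof -
  have "P (\<Sum>a\<in>A. Poly_Mapping.single a (Poly_Mapping.lookup x a))" if "finite A" "A \<subseteq> carrier G" for A
    using that by (induction A rule: finite_induct) (auto intro: assms)
  from this[of "Poly_Mapping.keys x"] show ?thesis
    using assms(1) by (simp add: carrier_group_ring flip: single_decomposition)
qed

lemma (in comm_group) group_ring_cring: "cring (group_ring G)"
proof -
  let ?R = "group_ring G"
  have closed: "x \<otimes>\<^bsub>?R\<^esub> y \<in> carrier ?R" if "x \<in> carrier ?R" "y \<in> carrier ?R" for x y
    using that(1)
  proof (induction rule: group_ring_induct)
    case (single h c)
    from that(2) show ?case
      by (induction rule: group_ring_induct) (use single in \<open>auto simp: group_ring_mult_single group_ring_distrib_left\<close>)
  qed (auto simp: group_ring_distrib_right)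
  have assoc: "x \<otimes>\<^bsub>?R\<^esub> y \<otimes>\<^bsub>?R\<^esub> z = x \<otimes>\<^bsub>?R\<^esub> (y \<otimes>\<^bsub>?R\<^esub> z)"
    if "x \<in> carrier ?R" "y \<in> carrier ?R" "z \<in> carrier ?R" for x y z
    using that(1)
  proof (induction rule: group_ring_induct)
    case (single h c)
    from that(2) show ?case
    proof (induction rule: group_ring_induct)
      case (single h' c')
      from that(3) show ?case
        by (induction rule: group_ring_induct)
          (use single \<open>h \<in> carrier G\<close> in \<open>auto simp: group_ring_mult_single group_ring_distrib_left m_assoc mult.assoc\<close>)
    qed (auto simp: group_ring_distrib_left group_ring_distrib_right)
  qed (auto simp: group_ring_distrib_right)
  have comm: "x \<otimes>\<^bsub>?R\<^esub> y = y \<otimes>\<^bsub>?R\<^esub> x" if "x \<in> carrier ?R" "y \<in> carrier ?R" for x y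
    using that(1)
  proof (induction rule: group_ring_induct)
    case (single h c)
    from that(2) show ?case
      by (induction rule: group_ring_induct)
        (use single in \<open>auto simp: group_ring_mult_single group_ring_distrib_left group_ring_distrib_right m_comm mult.commute\<close>)
  qed (auto simp: group_ring_distrib_left group_ring_distrib_right)
  have one: "\<one>\<^bsub>?R\<^esub> \<otimes>\<^bsub>?R\<^esub> x = x" if "x \<in> carrier ?R" for x
    using that
    by (induction rule: group_ring_induct) (auto simp: group_ring_mult_single group_ring_distrib_left)
  show ?thesis
  proof (intro cringI abelian_groupI comm_monoidI)
    fix x assume "x \<in> carrier ?R"
    then show "\<exists>y\<in>carrier ?R. y \<oplus>\<^bsub>?R\<^esub> x = \<zero>\<^bsub>?R\<^esub>"
      by (intro bexI[of _ "- x"]) auto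
  qed (auto intro: closed assoc comm one[simplified] simp: add.assoc group_ring_distrib_right add.commute)
qed

lemma gr_int_add: "gr_int G (c + d) = gr_int G c + gr_int G d"
  by (simp add: gr_int_def single_add)

lemma gr_int_diff: "gr_int G (c - d) = gr_int G c - gr_int G d"
  by (simp add: gr_int_def single_diff)

lemma gr_int_uminus: "gr_int G (- c) = - gr_int G c"
  by (simp add: gr_int_def single_uminus)

lemma gr_int_0 [simp]: "gr_int G 0 = 0"
  by (simp add: gr_int_def)

lemma gr_int_sum: "gr_int G (\<Sum>i\<in>I. f i) = (\<Sum>i\<in>I. gr_int G (f i))"
  by (induction I rule: infinite_finite_induct) (simp_all add: gr_int_add)

section \<open>Signs, integers and group elements in the ring\<close>

text \<open>
  \<open>signed u x\<close> is \<open>(-1)\<^sup>u x\<close> in an arbitrary additive group. Signs in this form move through sums, products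
  and coefficients without becoming elements of the ring.
\<close>

definition signed :: "nat \<Rightarrow> 'a::ab_group_add \<Rightarrow> 'a" where
  "signed u x = (if even u then x else - x)"

lemma signed_simps [simp]: "signed 0 x = x" "signed (Suc u) x = - signed u x" "signed u 0 = 0" "signed u (- x) = - signed u x"
  by (simp_all add: signed_def)

lemma signed_signed: "signed u (signed v x) = signed (u + v) x"
  by (simp add: signed_def)

lemma signed_sum: "signed u (\<Sum>i\<in>I. f i) = (\<Sum>i\<in>I. signed u (f i))"
  by (simp add: signed_def sum_negf)

lemma gr_int_signed: "gr_int G (signed u c) = signed u (gr_int G c)"
  by (simp add: signed_def gr_int_uminus)

lemma signed_closed [simp]: "x \<in> carrier (group_ring G) \<Longrightarrow> signed u x \<in> carrier (group_ring G)"
  by (simp add: signed_def)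

lemma group_ring_mult_signed:
  "signed u x \<otimes>\<^bsub>group_ring G\<^esub> y = signed u (x \<otimes>\<^bsub>group_ring G\<^esub> y)"
  "x \<otimes>\<^bsub>group_ring G\<^esub> signed u y = signed u (x \<otimes>\<^bsub>group_ring G\<^esub> y)"
  by (simp_all add: signed_def group_ring_mult_uminus)

context comm_group
begin

interpretation R: cring "group_ring G" by (rule group_ring_cring)

lemma gr_int_closed [simp]: "gr_int G c \<in> carrier (group_ring G)"
  by (simp add: gr_int_def)

lemma gr_int_mult: "gr_int G (c * d) = gr_int G c \<otimes>\<^bsub>group_ring G\<^esub> gr_int G d"
  by (simp add: gr_int_def group_ring_mult_single)

lemma gr_elem_mult: "gr_elem (h \<otimes> h') = gr_elem h \<otimes>\<^bsub>group_ring G\<^esub> gr_elem h'"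
  by (simp add: gr_elem_def group_ring_mult_single)

lemma gr_elem_one: "gr_elem \<one> = Poly_Mapping.single \<one> 1"
  by (simp add: gr_elem_def)

lemma gr_int_one: "gr_int G 1 = Poly_Mapping.single \<one> 1"
  by (simp add: gr_int_def)

lemma group_ring_one_mult [simp]:
  "x \<in> carrier (group_ring G) \<Longrightarrow> Poly_Mapping.single \<one> 1 \<otimes>\<^bsub>group_ring G\<^esub> x = x"
  "x \<in> carrier (group_ring G) \<Longrightarrow> x \<otimes>\<^bsub>group_ring G\<^esub> Poly_Mapping.single \<one> 1 = x"
  using R.l_one[of x] R.r_one[of x] by simp_all

lemma gr_int_sign_mult:
  assumes "x \<in> carrier (group_ring G)"
  shows "gr_int G ((-1) ^ u) \<otimes>\<^bsub>group_ring G\<^esub> x = signed u x"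
proof -
  have "gr_int G ((-1) ^ u) = signed u (\<one>\<^bsub>group_ring G\<^esub>)"
    by (simp add: gr_int_def signed_def single_uminus)
  then show ?thesis
    using assms by (simp add: group_ring_mult_signed)
qed

end

section \<open>Inner faces of the bar differential on words\<close>

text \<open>
  Positions are counted as in the bar differential: the letters number \<open>u\<close> and \<open>u + 1\<close> are combined,
  for \<open>1 \<le> u < length w\<close>.
\<close>

definition merge :: "('a \<Rightarrow> 'a \<Rightarrow> 'a) \<Rightarrow> nat \<Rightarrow> 'a list \<Rightarrow> 'a list" where
  "merge f u w = take (u - 1) w @ f (w ! (u - 1)) (w ! u) # drop (u + 1) w"

lemma length_merge: "1 \<le> u \<Longrightarrow> u < length w \<Longrightarrow> length (merge f u w) = length w - 1"
  by (simp add: merge_def)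

lemma merge_1 [simp]: "merge f (Suc 0) (x # y # w) = f x y # w"
  by (simp add: merge_def)

lemma merge_Suc [simp]: "1 \<le> u \<Longrightarrow> merge f (Suc u) (x # w) = x # merge f u w"
  by (cases u) (simp_all add: merge_def)

lemma take_merge_low:
  assumes "1 \<le> u" "u \<le> q" "q < length w"
  shows "take q (merge f u w) = merge f u (take (q + 1) w)" "drop q (merge f u w) = drop (q + 1) w"
  using assms by (simp_all add: merge_def take_Cons' drop_Cons' min_absorb2 drop_take)

lemma take_merge_high:
  assumes "q < u" "u < length w"
  shows "take q (merge f u w) = take q w" "drop q (merge f u w) = merge f (u - q) (drop q w)"
  using assms by (simp_all add: merge_def min_absorb1 drop_take add.commute)

lemma set_merge:
  assumes "1 \<le> u" "u < length w"
  shows "set (merge f u w) \<subseteq> insert (f (w ! (u - 1)) (w ! u)) (set w)"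
  using set_take_subset[of "u - 1" w] set_drop_subset[of "u + 1" w] by (auto simp: merge_def)

lemma map_merge:
  assumes "1 \<le> u" "u < length w"
    and "\<And>x y. x \<in> set w \<Longrightarrow> y \<in> set w \<Longrightarrow> \<phi> (f x y) = f' (\<phi> x) (\<phi> y)"
  shows "map \<phi> (merge f u w) = merge f' u (map \<phi> w)"
  using assms by (simp add: merge_def take_map drop_map)

text \<open>
  The faces that combine two letters, evaluated with their signs on a cochain \<open>\<phi>\<close>. The two faces that remove
  an outer letter are kept apart, as the first of them involves the action of the group.
\<close>

definition face_sum :: "('a \<Rightarrow> 'a \<Rightarrow> 'a) \<Rightarrow> ('a list \<Rightarrow> 'b::ab_group_add) \<Rightarrow> 'a list \<Rightarrow> 'b" where
  "face_sum f \<phi> w = (\<Sum>u\<in>{1..length w - 1}. signed u (\<phi> (merge f u w)))"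

lemma face_sum_cong:
  assumes "\<And>u. 1 \<le> u \<Longrightarrow> u < length w \<Longrightarrow> \<phi> (merge f u w) = \<psi> (merge f' u w')" "length w' = length w"
  shows "face_sum f \<phi> w = face_sum f' \<psi> w'"
  unfolding face_sum_def using assms by (intro sum.cong) auto

lemma face_sum_singleton [simp]: "face_sum f \<phi> [x] = 0"
  by (simp add: face_sum_def)

text \<open>
  The first inner face combines the first two letters, and all others keep the first letter. This
  permits induction on the word.
\<close>

lemma face_sum_Cons:
  "face_sum f \<phi> (x # y # w) = - \<phi> (f x y # w) - face_sum f (\<lambda>v. \<phi> (x # v)) (y # w)"
proof -
  have "face_sum f \<phi> (x # y # w) = (\<Sum>u\<in>{1..Suc (length w)}. signed u (\<phi> (merge f u (x # y # w))))"
    by (simp add: face_sum_def)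
  also have "\<dots> = - \<phi> (f x y # w) + (\<Sum>u\<in>{Suc 1..Suc (length w)}. signed u (\<phi> (merge f u (x # y # w))))"
    by (subst sum.atLeast_Suc_atMost) simp_all
  also have "(\<Sum>u\<in>{Suc 1..Suc (length w)}. signed u (\<phi> (merge f u (x # y # w)))) =
      (\<Sum>u\<in>{1..length w}. signed (Suc u) (\<phi> (merge f (Suc u) (x # y # w))))"
    by (rule sum.shift_bounds_cl_Suc_ivl)
  also have "\<dots> = - face_sum f (\<lambda>v. \<phi> (x # v)) (y # w)"
    by (simp add: face_sum_def sum_negf)
  finally show ?thesis by simp
qed

text \<open>
  Cutting a word after \<open>q\<close> letters separates its inner faces. Faces \<open>1, \<dots>, q\<close> combine letters among the
  first \<open>q + 1\<close>, so the initial piece of length \<open>q\<close> of the face is a face of the initial piece of length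
  \<open>q + 1\<close> of the word. The other faces only touch what comes after the first \<open>q\<close> letters. This is the
  Leibniz rule behind the Alexander-Whitney map, up to the outer faces.
\<close>

lemma face_sum_split:
  assumes "q < length w"
  shows "face_sum f (\<lambda>v. \<psi> (take q v) (drop q v)) w =
    face_sum f (\<lambda>v. \<psi> v (drop (q + 1) w)) (take (q + 1) w) +
    signed q (face_sum f (\<lambda>v. \<psi> (take q w) v) (drop q w))"
proof -
  let ?s = "\<lambda>u. signed u (\<psi> (take q (merge f u w)) (drop q (merge f u w)))"
  have "face_sum f (\<lambda>v. \<psi> (take q v) (drop q v)) w = sum ?s {1..length w - 1}"
    by (simp add: face_sum_def)
  also have "{1..length w - 1} = {1..q} \<union> {q + 1..length w - 1}" using assms by auto
  also have "sum ?s \<dots> = sum ?s {1..q} + sum ?s {q + 1..length w - 1}"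
    by (rule sum.union_disjoint) auto
  also have "sum ?s {1..q} = face_sum f (\<lambda>v. \<psi> v (drop (q + 1) w)) (take (q + 1) w)"
    unfolding face_sum_def using assms by (intro sum.cong) (simp_all add: take_merge_low)
  also have "sum ?s {q + 1..length w - 1} = signed q (face_sum f (\<lambda>v. \<psi> (take q w) v) (drop q w))"
    unfolding face_sum_def signed_sum using assms
    by (intro sum.reindex_bij_witness[of _ "\<lambda>u. u + q" "\<lambda>u. u - q"])
      (auto simp: take_merge_high signed_signed)
  finally show ?thesis .
qed

lemma face_sum_mult_left: "face_sum f (\<lambda>v. (c::int) * \<phi> v) w = c * face_sum f \<phi> w"
  by (simp add: face_sum_def sum_distrib_left signed_def if_distrib cong: if_cong)

section \<open>The carry cocycle and its cup powers\<close>

text \<open>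
  The carry \<open>(x, y) \<mapsto> \<lfloor>(x + y) / m\<rfloor>\<close> of the addition of residues is the 2-cocycle that classifies the
  extension \<open>\<int> \<rightarrow> \<int> \<rightarrow> \<int>/m\<close>. On words of even length this function is the corresponding cup power of
  that cocycle; its value on words of odd length is a default.
\<close>

fun carries :: "nat \<Rightarrow> nat list \<Rightarrow> int" where
  "carries m [] = 1"
| "carries m [x] = 0"
| "carries m (x # y # v) = int ((x + y) div m) * carries m v"

text \<open>
  Both sides count how often \<open>m\<close> is subtracted in the reduction of \<open>x + y + z\<close>, for the two bracketings.
\<close>

lemma carry_cocycle:
  fixes x y z m :: nat
  shows "(y + z) div m + (x + (y + z) mod m) div m = ((x + y) mod m + z) div m + (x + y) div m"
proof (cases "m = 0")
  case False
  have mods: "(x + (y + z) mod m) mod m = ((x + y) mod m + z) mod m"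
    by (simp add: mod_simps add.assoc)
  have "m * ((y + z) div m) + m * ((x + (y + z) mod m) div m) + (x + (y + z) mod m) mod m = x + y + z"
    using mult_div_mod_eq[of m "y + z"] mult_div_mod_eq[of m "x + (y + z) mod m"] by linarith
  moreover have "m * (((x + y) mod m + z) div m) + m * ((x + y) div m) + ((x + y) mod m + z) mod m = x + y + z"
    using mult_div_mod_eq[of m "x + y"] mult_div_mod_eq[of m "(x + y) mod m + z"] by linarith
  ultimately have "m * ((y + z) div m + (x + (y + z) mod m) div m) = m * (((x + y) mod m + z) div m + (x + y) div m)"
    using mods unfolding distrib_left by linarith
  then show ?thesis using False by simp
qed simp

text \<open>
  A cup power of a cocycle is a cocycle. The induction removes the first two letters \<open>x\<close>, \<open>y\<close>. The
  faces that keep both are the carry of \<open>x + y\<close> times faces of the remaining word, and by the induction hypothesis they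
  sum to a multiple of the cup power of the letters after the third. The other three faces are multiples of it as well, and
  the total coefficient vanishes by the cocycle identity for the first three letters.
\<close>

lemma carries_cocycle:
  assumes "odd (length v)"
  shows "carries m (tl v) + face_sum (\<lambda>x y. (x + y) mod m) (carries m) v - carries m (butlast v) = 0"
  using assms
proof (induction v rule: induct_list012)
  case (3 x y v)
  then obtain z s where v: "v = z # s" by (cases v) auto
  let ?F = "face_sum (\<lambda>x y. (x + y) mod m)"
  have IH: "carries m s + ?F (carries m) (z # s) - carries m (butlast (z # s)) = 0"
    using 3 v by simp
  have "?F (carries m) (x # y # v) = - carries m ((x + y) mod m # z # s) +
      carries m (x # (y + z) mod m # s) + ?F (\<lambda>v. carries m (x # y # v)) (z # s)"
    by (simp add: v face_sum_Cons)
  also have "?F (\<lambda>v. carries m (x # y # v)) (z # s) = int ((x + y) div m) * ?F (carries m) (z # s)"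
    by (simp add: face_sum_mult_left)
  also have "?F (carries m) (z # s) = carries m (butlast (z # s)) - carries m s"
    using IH by simp
  finally have eq: "carries m (tl (x # y # v)) + ?F (carries m) (x # y # v) - carries m (butlast (x # y # v)) =
    (int ((y + z) div m) + int ((x + (y + z) mod m) div m) - int (((x + y) mod m + z) div m) - int ((x + y) div m))
      * carries m s"
    by (simp add: v algebra_simps)
  have "int ((y + z) div m) + int ((x + (y + z) mod m) div m) =
    int (((x + y) mod m + z) div m) + int ((x + y) div m)"
    using carry_cocycle[of y z m x] by linarith
  then show ?case unfolding eq by simp
qed simp_all

text \<open>
  A residue 0 never produces a carry, so the cochain is normalized.
\<close>

lemma carries_zero:
  assumes "0 \<in> set v" "\<And>x. x \<in> set v \<Longrightarrow> x < m"
  shows "carries m v = 0"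
  using assms by (induction m v rule: carries.induct) auto

section \<open>Internal direct products of cyclic groups\<close>

text \<open>
  The internal direct product of the cyclic subgroups generated by \<open>g 1, \<dots>, g n\<close>. The third assumption
  says that the order of \<open>g i\<close> divides \<open>m i\<close>; uniqueness of the exponents makes \<open>m i\<close> the exact order.
\<close>

locale cyclic_decomposition = comm_group G for G (structure) +
  fixes g :: "nat \<Rightarrow> 'a" and m :: "nat \<Rightarrow> nat" and n :: nat
  assumes g_closed: "i \<in> {1..n} \<Longrightarrow> g i \<in> carrier G"
    and m_pos: "i \<in> {1..n} \<Longrightarrow> m i > 0"
    and g_pow_m: "i \<in> {1..n} \<Longrightarrow> g i [^] m i = \<one>"
    and unique_exponents: "h \<in> carrier G \<Longrightarrow>
      \<exists>!e. e \<in> (\<Pi>\<^sub>E j\<in>{1..n}. {..<m j}) \<and> h = (\<Otimes>j\<in>{1..n}. g j [^] e j)"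
begin

interpretation R: cring "group_ring G" by (rule group_ring_cring)

abbreviation star (infixl "\<star>" 70) where "x \<star> y \<equiv> x \<otimes>\<^bsub>group_ring G\<^esub> y"
abbreviation RC where "RC \<equiv> carrier (group_ring G)"

abbreviation expo where "expo \<equiv> exponents G g m n"

lemma exponents_char:
  assumes "h \<in> carrier G"
  shows "expo h \<in> (\<Pi>\<^sub>E j\<in>{1..n}. {..<m j})" "h = (\<Otimes>j\<in>{1..n}. g j [^] expo h j)"
  using theI'[OF unique_exponents[OF assms]] unfolding exponents_def by auto

lemma exponents_less: "h \<in> carrier G \<Longrightarrow> j \<in> {1..n} \<Longrightarrow> expo h j < m j"
  using exponents_char(1)[of h] by (auto simp: PiE_def)

lemma exponents_eqI:
  assumes "h \<in> carrier G" "e \<in> (\<Pi>\<^sub>E j\<in>{1..n}. {..<m j})" "h = (\<Otimes>j\<in>{1..n}. g j [^] e j)"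
  shows "expo h = e"
  unfolding exponents_def using assms by (intro the1_equality unique_exponents) auto

lemma g_pow_closed [simp]: "i \<in> {1..n} \<Longrightarrow> g i [^] (k::nat) \<in> carrier G"
  by (simp add: g_closed)

lemma g_pow_mod: "i \<in> {1..n} \<Longrightarrow> g i [^] (k mod m i) = g i [^] k"
proof -
  assume i: "i \<in> {1..n}"
  have "g i [^] k = g i [^] (m i * (k div m i) + k mod m i)" by simp
  also have "\<dots> = (g i [^] m i) [^] (k div m i) \<otimes> g i [^] (k mod m i)"
    using i by (simp only: nat_pow_mult[symmetric] nat_pow_pow g_closed)
  also have "\<dots> = g i [^] (k mod m i)" using i by (simp add: g_pow_m)
  finally show ?thesis by simp
qed

lemma exponents_mult:
  assumes "h \<in> carrier G" "h' \<in> carrier G" "j \<in> {1..n}"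
  shows "expo (h \<otimes> h') j = (expo h j + expo h' j) mod m j"
proof -
  define e where "e = (\<lambda>j\<in>{1..n}. (expo h j + expo h' j) mod m j)"
  have "h \<otimes> h' = (\<Otimes>j\<in>{1..n}. g j [^] expo h j) \<otimes> (\<Otimes>j\<in>{1..n}. g j [^] expo h' j)"
    using exponents_char(2) assms by metis
  also have "\<dots> = (\<Otimes>j\<in>{1..n}. g j [^] expo h j \<otimes> g j [^] expo h' j)"
    by (rule finprod_multf[symmetric]) auto
  also have "\<dots> = (\<Otimes>j\<in>{1..n}. g j [^] e j)"
    by (intro finprod_cong') (auto simp: e_def nat_pow_mult g_closed g_pow_mod)
  finally have "expo (h \<otimes> h') = e"
    using assms m_pos by (intro exponents_eqI) (auto simp: e_def)
  then show ?thesis using assms by (simp add: e_def)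
qed

lemma exponents_one:
  assumes "j \<in> {1..n}"
  shows "expo \<one> j = 0"
proof -
  have "expo \<one> = (\<lambda>j\<in>{1..n}. 0)"
    by (rule exponents_eqI) (auto simp: m_pos intro!: finprod_one_eqI[symmetric])
  then show ?thesis using assms by simp
qed

section \<open>Comparison over one cyclic factor\<close>

lemma gr_partial_closed [simp]: "i \<in> {1..n} \<Longrightarrow> gr_partial G g i r \<in> RC"
  by (simp add: gr_partial_def)

lemma gr_N_closed [simp]: "i \<in> {1..n} \<Longrightarrow> gr_N G g m i \<in> RC"
  by (simp add: gr_N_def)

lemma gr_T_closed [simp]: "i \<in> {1..n} \<Longrightarrow> gr_T G g i \<in> RC"
  using g_closed by (simp add: gr_T_def)

lemma gr_partial_0 [simp]: "gr_partial G g i 0 = 0"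
  by (simp add: gr_partial_def)

lemma gr_partial_m: "gr_partial G g i (m i) = gr_N G g m i"
  by (simp add: gr_partial_def gr_N_def)

lemma gr_T_mult_partial:
  assumes "i \<in> {1..n}"
  shows "gr_T G g i \<star> gr_partial G g i r = gr_elem (g i [^] r) - Poly_Mapping.single \<one> 1"
proof (induction r)
  case (Suc r)
  have "gr_T G g i \<star> gr_elem (g i [^] r) = gr_elem (g i [^] Suc r) - gr_elem (g i [^] r)"
    using assms
    by (simp add: gr_T_def group_ring_mult_diff g_closed m_comm flip: gr_elem_mult)
  then show ?case
    using Suc by (simp add: gr_partial_def group_ring_distrib_left)
qed (simp add: gr_partial_def gr_elem_def)

lemma gr_partial_add:
  assumes "i \<in> {1..n}"
  shows "gr_partial G g i (r + s) = gr_partial G g i r + gr_elem (g i [^] r) \<star> gr_partial G g i s"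
  using assms by (induction s)
    (simp_all add: gr_partial_def group_ring_distrib_left add.assoc g_closed nat_pow_mult flip: gr_elem_mult)

lemma gr_partial_mult_m:
  assumes "i \<in> {1..n}"
  shows "gr_partial G g i (m i * q) = gr_int G (int q) \<star> gr_N G g m i"
proof (induction q)
  case (Suc q)
  have "gr_partial G g i (m i * Suc q) = gr_partial G g i (m i + m i * q)" by simp
  also have "\<dots> = gr_N G g m i + gr_int G (int q) \<star> gr_N G g m i"
    using assms Suc by (simp add: gr_partial_add gr_partial_m g_pow_m gr_elem_one)
  also have "\<dots> = gr_int G (int (Suc q)) \<star> gr_N G g m i"
    using assms by (simp add: gr_int_add gr_int_one group_ring_distrib_right)
  finally show ?case .
qed simp

text \<open>
  Write \<open>x + y = m q + r\<close>. The element \<open>(g)\<^sub>x\<close> is the Fox derivative of \<open>g\<^sup>x\<close>, hence \<open>(g)\<^sub>x + g\<^sup>x (g)\<^sub>y\<close>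
  is \<open>(g)\<^bsub>m q + r\<^esub>\<close>, and each of the \<open>q\<close> full periods contributes one copy of \<open>N\<close>. The failure of
  \<open>(g)\<close> to be a crossed homomorphism on residues is thus the carry times \<open>N\<close>.
\<close>

lemma gr_partial_carry:
  assumes "i \<in> {1..n}"
  shows "gr_partial G g i x + gr_elem (g i [^] x) \<star> gr_partial G g i y =
    gr_int G (int ((x + y) div m i)) \<star> gr_N G g m i + gr_partial G g i ((x + y) mod m i)"
proof -
  define q r where "q = (x + y) div m i" and "r = (x + y) mod m i"
  have xy: "x + y = m i * q + r" unfolding q_def r_def by (rule mult_div_mod_eq[symmetric])
  have "g i [^] (m i * q) = \<one>"
    using nat_pow_pow[OF g_closed[OF assms], of "m i" q] by (simp only: g_pow_m[OF assms] nat_pow_one)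
  then have "gr_partial G g i (m i * q + r) = gr_int G (int q) \<star> gr_N G g m i + gr_partial G g i r"
    by (simp only: gr_partial_add[OF assms] gr_partial_mult_m[OF assms] gr_elem_one
        group_ring_one_mult gr_partial_closed[OF assms])
  moreover have "gr_partial G g i x + gr_elem (g i [^] x) \<star> gr_partial G g i y = gr_partial G g i (m i * q + r)"
    using gr_partial_add[OF assms, of x y] by (simp only: xy)
  ultimately show ?thesis
    by (simp only: q_def r_def)
qed

text \<open>
  The comparison map into the periodic resolution of one cyclic group, on a word of residues: a cup
  power of the carry cocycle in even degree, preceded by a Fox derivative in odd degree.
\<close>

definition cyclic_coeff :: "nat \<Rightarrow> nat list \<Rightarrow> 'a \<Rightarrow>\<^sub>0 int" where
  "cyclic_coeff i v = (if even (length v) then gr_int G (carries (m i) v)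
     else gr_partial G g i (hd v) \<star> gr_int G (carries (m i) (tl v)))"

lemma cyclic_coeff_closed [simp]: "i \<in> {1..n} \<Longrightarrow> cyclic_coeff i v \<in> RC"
  by (simp add: cyclic_coeff_def)

text \<open>
  The differential of the periodic resolution out of degree \<open>k\<close>.
\<close>

definition cyclic_diff :: "nat \<Rightarrow> nat \<Rightarrow> 'a \<Rightarrow>\<^sub>0 int" where
  "cyclic_diff i k = (if even k then gr_N G g m i else gr_T G g i)"

lemma cyclic_diff_closed [simp]: "i \<in> {1..n} \<Longrightarrow> cyclic_diff i k \<in> RC"
  by (simp add: cyclic_diff_def)

lemma gr_int_face_sum: "gr_int G (face_sum f \<phi> w) = face_sum f (\<lambda>v. gr_int G (\<phi> v)) w"
  by (simp add: face_sum_def gr_int_sum gr_int_signed)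

lemma face_sum_mult:
  "face_sum f (\<lambda>v. x \<star> \<phi> v) w = x \<star> face_sum f \<phi> w"
  "face_sum f (\<lambda>v. \<phi> v \<star> x) w = face_sum f \<phi> w \<star> x"
  by (simp_all add: face_sum_def group_ring_mult_sum group_ring_mult_signed)

text \<open>
  The chain map property over a single cyclic factor. In odd degree, the cocycle identity for
  the carries reduces the right side to \<open>g\<^sup>x - 1 = T (g)\<^sub>x\<close> times a cup power. In even degree, that identity for the
  tail of the word leaves \<open>(g)\<^sub>x + g\<^sup>x (g)\<^sub>y - (g)\<^sub>z\<close>, where \<open>z\<close> is the residue of \<open>x + y\<close>, as coefficient
  of a cup power, and this is the carry of \<open>x + y\<close> times \<open>N\<close>.
\<close>

lemma cyclic_coeff_boundary:
  assumes i: "i \<in> {1..n}" and v: "v \<noteq> []"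
  shows "cyclic_diff i (length v) \<star> cyclic_coeff i v =
    gr_elem (g i [^] hd v) \<star> cyclic_coeff i (tl v)
      + face_sum (\<lambda>x y. (x + y) mod m i) (cyclic_coeff i) v
      + signed (length v) (cyclic_coeff i (butlast v))"
proof (cases "even (length v)")
  case True
  then obtain x y s where v_eq: "v = x # y # s"
    using v by (cases v rule: remdups_adj.cases) auto
  let ?t = "y # s" and ?E = "carries (m i)" and ?p = "gr_partial G g i"
  let ?F = "face_sum (\<lambda>x y. (x + y) mod m i)"
  have ev: "even (length s)" using True v_eq by simp
  have "?F (\<lambda>u. cyclic_coeff i (x # u)) ?t = ?F (\<lambda>u. ?p x \<star> gr_int G (?E u)) ?t"
    using ev by (intro face_sum_cong) (auto simp: cyclic_coeff_def length_merge)
  also have "\<dots> = ?p x \<star> gr_int G (?F ?E ?t)"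
    by (simp add: face_sum_mult gr_int_face_sum)
  also have "?F ?E ?t = ?E (butlast ?t) - ?E s"
    using carries_cocycle[of ?t "m i"] ev by simp
  finally have "?F (cyclic_coeff i) v = - (?p ((x + y) mod m i) \<star> gr_int G (?E s))
      - ?p x \<star> gr_int G (?E (butlast ?t)) + ?p x \<star> gr_int G (?E s)"
    using ev by (simp add: v_eq face_sum_Cons cyclic_coeff_def gr_int_diff group_ring_mult_diff)
  then have "gr_elem (g i [^] hd v) \<star> cyclic_coeff i (tl v) + ?F (cyclic_coeff i) v
      + signed (length v) (cyclic_coeff i (butlast v)) =
    gr_elem (g i [^] x) \<star> (?p y \<star> gr_int G (?E s)) - (?p ((x + y) mod m i) \<star> gr_int G (?E s))
      + ?p x \<star> gr_int G (?E s)"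
    using ev by (simp add: v_eq cyclic_coeff_def signed_def)
  also have "\<dots> = (gr_partial G g i x + gr_elem (g i [^] x) \<star> gr_partial G g i y - ?p ((x + y) mod m i)) \<star> gr_int G (?E s)"
    using i by (simp add: group_ring_distrib_right group_ring_mult_diff R.m_assoc)
  also have "\<dots> = gr_N G g m i \<star> gr_int G (?E v)"
    using i by (simp only: gr_partial_carry) (simp add: v_eq gr_int_mult R.m_ac)
  finally show ?thesis using True by (simp add: cyclic_diff_def cyclic_coeff_def)
next
  case False
  then obtain x t where v_eq: "v = x # t"
    using v by (cases v) auto
  let ?E = "carries (m i)" and ?p = "gr_partial G g i"
  let ?F = "face_sum (\<lambda>x y. (x + y) mod m i)"
  have ev: "even (length t)" using False v_eq by simp
  have "?F (cyclic_coeff i) v = gr_int G (?F ?E v)"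
    unfolding gr_int_face_sum using False by (intro face_sum_cong) (auto simp: cyclic_coeff_def length_merge)
  also have "?F ?E v = ?E (butlast v) - ?E t"
    using carries_cocycle[of v "m i"] False v_eq by simp
  finally have faces: "?F (cyclic_coeff i) v = gr_int G (?E (butlast v)) - gr_int G (?E t)"
    by (simp add: gr_int_diff)
  have "cyclic_coeff i (tl v) = gr_int G (?E t)" "cyclic_coeff i (butlast v) = gr_int G (?E (butlast v))"
    using ev False by (simp_all add: v_eq cyclic_coeff_def)
  with faces have "gr_elem (g i [^] hd v) \<star> cyclic_coeff i (tl v) + ?F (cyclic_coeff i) v
      + signed (length v) (cyclic_coeff i (butlast v)) = gr_elem (g i [^] x) \<star> gr_int G (?E t) - gr_int G (?E t)"
    using False by (simp add: v_eq signed_def)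
  also have "\<dots> = (gr_elem (g i [^] x) - Poly_Mapping.single \<one> 1) \<star> gr_int G (?E t)"
    using i by (simp add: group_ring_mult_diff)
  also have "\<dots> = gr_T G g i \<star> (?p x \<star> gr_int G (?E t))"
    using i by (simp add: R.m_assoc flip: gr_T_mult_partial)
  finally show ?thesis using False by (simp add: cyclic_diff_def cyclic_coeff_def v_eq)
qed

lemma cyclic_coeff_zero:
  assumes "0 \<in> set v" "\<And>x. x \<in> set v \<Longrightarrow> x < m i"
  shows "cyclic_coeff i v = 0"
proof -
  have "carries (m i) (tl v) = 0" if "hd v \<noteq> 0"
    using that assms by (cases v) (auto intro!: carries_zero)
  then show ?thesis
    using carries_zero[OF assms] by (cases "hd v = 0") (auto simp: cyclic_coeff_def)
qed

end

section \<open>Comparison coefficients for a product of cyclic factors\<close>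

context cyclic_decomposition
begin

interpretation R: cring "group_ring G" by (rule group_ring_cring)

text \<open>
  The projection of the product of the letters of \<open>v\<close> to the subgroup generated by \<open>g 1, \<dots>, g r\<close>.
\<close>

definition word_prod :: "nat \<Rightarrow> 'a list \<Rightarrow> 'a" where
  "word_prod r v = (\<Otimes>j\<in>{1..r}. g j [^] sum_list (map (\<lambda>h. expo h j) v))"

lemma word_prod_closed [simp]: "r \<le> n \<Longrightarrow> word_prod r v \<in> carrier G"
  unfolding word_prod_def by (rule finprod_closed) auto

lemma word_prod_append:
  assumes "r \<le> n"
  shows "word_prod r (v @ v') = word_prod r v \<otimes> word_prod r v'"
proof -
  have "word_prod r (v @ v') =
      (\<Otimes>j\<in>{1..r}. g j [^] sum_list (map (\<lambda>h. expo h j) v) \<otimes> g j [^] sum_list (map (\<lambda>h. expo h j) v'))"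
    unfolding word_prod_def using assms by (intro finprod_cong') (auto simp: nat_pow_mult g_closed)
  also have "\<dots> = word_prod r v \<otimes> word_prod r v'"
    unfolding word_prod_def using assms by (intro finprod_multf) auto
  finally show ?thesis .
qed

lemma word_prod_pair:
  assumes "r \<le> n" "h \<in> carrier G" "h' \<in> carrier G"
  shows "word_prod r [h \<otimes> h'] = word_prod r [h, h']"
  unfolding word_prod_def using assms
  by (intro finprod_cong') (auto simp: exponents_mult g_pow_mod)

lemma word_prod_merge:
  assumes "r \<le> n" "set w \<subseteq> carrier G" "1 \<le> u" "u < length w"
  shows "word_prod r (merge (\<otimes>) u w) = word_prod r w"
proof -
  have "w = take (u - 1) w @ [w ! (u - 1), w ! u] @ drop (u + 1) w"
    using assms(3,4) id_take_nth_drop[of "u - 1" w] Cons_nth_drop_Suc[of u w] by simp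
  then have "word_prod r w =
      word_prod r (take (u - 1) w) \<otimes> (word_prod r [w ! (u - 1), w ! u] \<otimes> word_prod r (drop (u + 1) w))"
    using word_prod_append[OF assms(1)] by metis
  moreover have "merge (\<otimes>) u w = take (u - 1) w @ [w ! (u - 1) \<otimes> w ! u] @ drop (u + 1) w"
    by (simp add: merge_def)
  moreover have "word_prod r [w ! (u - 1) \<otimes> w ! u] = word_prod r [w ! (u - 1), w ! u]"
    using assms by (intro word_prod_pair) (auto simp: subset_iff)
  ultimately show ?thesis
    by (simp only: word_prod_append[OF assms(1)])
qed

lemma word_prod_Suc:
  assumes "Suc r \<le> n"
  shows "word_prod (Suc r) [h] = word_prod r [h] \<otimes> g (Suc r) [^] expo h (Suc r)"
proof -
  have "{1..Suc r} = insert (Suc r) {1..r}" by auto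
  then show ?thesis
    using assms by (simp add: word_prod_def m_comm Pi_def)
qed

lemma word_prod_single: "h \<in> carrier G \<Longrightarrow> word_prod n [h] = h"
  using exponents_char(2)[of h] by (simp add: word_prod_def)

definition word_coeff :: "nat \<Rightarrow> 'a list \<Rightarrow> 'a \<Rightarrow>\<^sub>0 int" where
  "word_coeff j v = cyclic_coeff j (map (\<lambda>h. expo h j) v)"

lemma word_coeff_closed [simp]: "j \<in> {1..n} \<Longrightarrow> word_coeff j v \<in> RC"
  by (simp add: word_coeff_def)

text \<open>
  The exponent of \<open>g j\<close> is a homomorphism to the residues modulo \<open>m j\<close>, so the identity for residues
  pulls back to words in the group.
\<close>

lemma word_coeff_boundary:
  assumes j: "j \<in> {1..n}" and v: "v \<noteq> []" "set v \<subseteq> carrier G"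
  shows "cyclic_diff j (length v) \<star> word_coeff j v =
    gr_elem (g j [^] expo (hd v) j) \<star> word_coeff j (tl v)
      + face_sum (\<otimes>) (word_coeff j) v + signed (length v) (word_coeff j (butlast v))"
proof -
  have "face_sum (\<otimes>) (word_coeff j) v =
    face_sum (\<lambda>x y. (x + y) mod m j) (cyclic_coeff j) (map (\<lambda>h. expo h j) v)"
  proof (rule face_sum_cong)
    fix u assume u: "1 \<le> u" "u < length v"
    have "map (\<lambda>h. expo h j) (merge (\<otimes>) u v) =
        merge (\<lambda>x y. (x + y) mod m j) u (map (\<lambda>h. expo h j) v)"
      using u v j by (intro map_merge) (auto intro!: exponents_mult)
    then show "word_coeff j (merge (\<otimes>) u v) =
        cyclic_coeff j (merge (\<lambda>x y. (x + y) mod m j) u (map (\<lambda>h. expo h j) v))"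
      by (simp add: word_coeff_def)
  qed simp
  then show ?thesis
    using cyclic_coeff_boundary[OF j, of "map (\<lambda>h. expo h j) v"] v
    by (simp add: word_coeff_def map_tl map_butlast hd_map)
qed

lemma word_coeff_zero:
  assumes "j \<in> {1..n}" "set v \<subseteq> carrier G" "\<one> \<in> set v"
  shows "word_coeff j v = 0"
  unfolding word_coeff_def
proof (rule cyclic_coeff_zero)
  show "0 \<in> set (map (\<lambda>h. expo h j) v)"
    using assms(3) exponents_one[OF assms(1)] by (metis (no_types, lifting) image_eqI list.set_map)
  show "x < m j" if "x \<in> set (map (\<lambda>h. expo h j) v)" for x
    using that assms(2) exponents_less[OF _ assms(1)] by auto
qed

text \<open>
  The coefficient of \<open>\<Phi>(a\<^sub>1, \<dots>, a\<^sub>r)\<close> in the image of the word \<open>w\<close> for the product of the first \<open>r\<close>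
  factors. The recursion is the Alexander-Whitney map: the first \<open>q = a\<^sub>r\<close> letters go to the last factor,
  the remaining letters to the other factors, translated by the product of the letters before them. The
  sign comes from interchanging the two tensor factors.
\<close>

primrec comparison_coeff :: "nat \<Rightarrow> 'a list \<Rightarrow> (nat \<Rightarrow> nat) \<Rightarrow> 'a \<Rightarrow>\<^sub>0 int" where
  "comparison_coeff 0 w a = (if w = [] then Poly_Mapping.single \<one> 1 else 0)"
| "comparison_coeff (Suc r) w a = (let q = a (Suc r) in
    signed (q * (length w - q))
      (word_coeff (Suc r) (take q w) \<star> gr_elem (word_prod r (take q w)) \<star> comparison_coeff r (drop q w) a))"

lemma comparison_coeff_closed [simp]: "r \<le> n \<Longrightarrow> comparison_coeff r w a \<in> RC"
  by (induction r arbitrary: w) (auto simp: Let_def)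

lemma comparison_coeff_cong: "(\<And>j. j \<in> {1..r} \<Longrightarrow> a j = b j) \<Longrightarrow> comparison_coeff r w a = comparison_coeff r w b"
  by (induction r arbitrary: w) (auto simp: Let_def)

text \<open>
  An identity letter lies in the segment of some factor, where the coefficient is normalized.
\<close>

lemma comparison_coeff_zero:
  assumes "r \<le> n" "set w \<subseteq> carrier G" "\<one> \<in> set w" "(\<Sum>j\<in>{1..r}. a j) = length w"
  shows "comparison_coeff r w a = 0"
  using assms
proof (induction r arbitrary: w)
  case (Suc r)
  let ?q = "a (Suc r)"
  have "set w = set (take ?q w) \<union> set (drop ?q w)"
    by (metis append_take_drop_id set_append)
  then consider "\<one> \<in> set (take ?q w)" | "\<one> \<in> set (drop ?q w)"
    using Suc.prems(3) by auto
  then show ?case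
  proof cases
    case 1
    then have "word_coeff (Suc r) (take ?q w) = 0"
      using Suc.prems set_take_subset[of ?q w] by (intro word_coeff_zero) auto
    then show ?thesis by (simp add: Let_def)
  next
    case 2
    then have "comparison_coeff r (drop ?q w) a = 0"
      using Suc.prems set_drop_subset[of ?q w] by (intro Suc.IH) auto
    then show ?thesis by (simp add: Let_def)
  qed
qed simp

text \<open>
  The signs in the induction step below: \<open>x1\<close>, \<open>x2\<close>, \<open>x3\<close> stand for the first face, the inner faces
  and the last face of \<open>V\<close>, while \<open>x3\<close>, \<open>y2\<close>, \<open>y3\<close> are those of \<open>W\<close>. The two occurrences of \<open>x3\<close> cancel.
\<close>

lemma sign_bookkeeping:
  fixes x1 x2 x3 y2 y3 :: "'x::ab_group_add"
  shows "signed (q * Suc p) (x3 + y2 + signed (Suc p) y3) + signed (q * p) (x1 + x2 + signed (Suc q) x3) =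
    signed (q * p) x1 + signed (q * p) (x2 + signed q y2) + signed (Suc (p + q)) (signed (q * p) y3)"
  by (cases "even p"; cases "even q") (simp_all add: signed_def)

text \<open>
  The chain map property in coefficients, by induction on the number \<open>r\<close> of factors. Let \<open>V\<close> be the first
  \<open>q + 1\<close> letters of the word and \<open>W\<close> the word without its first \<open>q\<close> letters, so that they overlap in one
  letter. The summands for the first factors are evaluated on \<open>W\<close> by the induction hypothesis, the summand
  for the last factor on \<open>V\<close> by the identity over one cyclic group. The last face of \<open>V\<close> and the first
  face of \<open>W\<close> both remove the common letter; they cancel. The other faces of \<open>V\<close> and \<open>W\<close> are the faces of
  the whole word.
\<close>

lemma comparison_coeff_boundary:
  assumes "r \<le> n" "set w \<subseteq> carrier G" "length w = Suc (\<Sum>j\<in>{1..r}. a j)"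
  shows "(\<Sum>i\<in>{1..r}. signed (\<Sum>l\<in>{1..<i}. a l) (cyclic_diff i (Suc (a i)) \<star> comparison_coeff r w (a(i := Suc (a i))))) =
    gr_elem (word_prod r [hd w]) \<star> comparison_coeff r (tl w) a
      + face_sum (\<otimes>) (\<lambda>v. comparison_coeff r v a) w + signed (length w) (comparison_coeff r (butlast w) a)"
  using assms
proof (induction r arbitrary: w)
  case 0
  then obtain h where "w = [h]" by (cases w) auto
  then show ?case by (simp add: word_prod_def gr_elem_one)
next
  case (Suc r)
  define q p where "q = a (Suc r)" and "p = (\<Sum>j\<in>{1..r}. a j)"
  \<comment> \<open>The two words overlap in one letter, the first of \<open>W\<close>.\<close>
  define V W where "V = take (Suc q) w" and "W = drop q w"
  have r: "r \<le> n" "Suc r \<in> {1..n}" using Suc.prems(1) by auto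
  have len: "length w = Suc (p + q)" using Suc.prems(3) by (simp add: p_def q_def)
  have V: "V \<noteq> []" "set V \<subseteq> carrier G" "length V = Suc q" "hd V = hd w" "tl V = take q (tl w)" "butlast V = take q w"
    using len Suc.prems(2) set_take_subset[of "Suc q" w]
    by (auto simp: V_def hd_take butlast_take tl_take)
  have W: "W \<noteq> []" "set W \<subseteq> carrier G" "length W = Suc p" "tl W = drop (Suc q) w" "butlast W = drop q (butlast w)"
    using len Suc.prems(2) set_drop_subset[of q w]
    by (auto simp: W_def drop_Suc tl_drop butlast_drop)
  have V_W: "V = take q w @ [hd W]"
    using len by (simp add: V_def W_def hd_drop_conv_nth take_Suc_conv_app_nth)
  define c where "c = word_coeff (Suc r) (take q w)"
  define A where "A = c \<star> gr_elem (word_prod r (take q w))"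
  define P where "P = gr_elem (word_prod r V)"
  define B where "B = comparison_coeff r (drop (Suc q) w) a"
  define x where "x = gr_elem (g (Suc r) [^] expo (hd w) (Suc r)) \<star> word_coeff (Suc r) (tl V)"
  have closed: "c \<in> RC" "P \<in> RC" "B \<in> RC" "x \<in> RC"
    using r by (auto simp: c_def P_def B_def x_def)
  \<comment> \<open>\<open>A\<close> commutes with the differentials of the first \<open>r\<close> factors, which leaves the boundary of \<open>W\<close>.\<close>
  have low: "(\<Sum>i\<in>{1..r}. signed (\<Sum>l\<in>{1..<i}. a l)
        (cyclic_diff i (Suc (a i)) \<star> comparison_coeff (Suc r) w (a(i := Suc (a i))))) =
      signed (q * Suc p) (c \<star> P \<star> B + A \<star> face_sum (\<otimes>) (\<lambda>v. comparison_coeff r v a) W + signed (Suc p) (A \<star> comparison_coeff r (butlast W) a))"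
  proof -
    have "signed (\<Sum>l\<in>{1..<i}. a l) (cyclic_diff i (Suc (a i)) \<star> comparison_coeff (Suc r) w (a(i := Suc (a i)))) =
        signed (q * Suc p) (A \<star> signed (\<Sum>l\<in>{1..<i}. a l) (cyclic_diff i (Suc (a i)) \<star> comparison_coeff r W (a(i := Suc (a i)))))"
      if i: "i \<in> {1..r}" for i
    proof -
      let ?b = "a(i := Suc (a i))"
      have "?b (Suc r) = q" using i by (simp add: q_def)
      then have "comparison_coeff (Suc r) w ?b = signed (q * Suc p) (A \<star> comparison_coeff r W ?b)"
        by (simp add: Let_def len A_def c_def W_def)
      moreover have "cyclic_diff i (Suc (a i)) \<star> (A \<star> comparison_coeff r W ?b) = A \<star> (cyclic_diff i (Suc (a i)) \<star> comparison_coeff r W ?b)"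
        using i r closed by (simp add: A_def R.m_ac)
      ultimately show ?thesis
        by (simp add: group_ring_mult_signed signed_signed add.commute)
    qed
    then have "(\<Sum>i\<in>{1..r}. signed (\<Sum>l\<in>{1..<i}. a l)
        (cyclic_diff i (Suc (a i)) \<star> comparison_coeff (Suc r) w (a(i := Suc (a i))))) =
      signed (q * Suc p) (A \<star> (\<Sum>i\<in>{1..r}. signed (\<Sum>l\<in>{1..<i}. a l) (cyclic_diff i (Suc (a i)) \<star> comparison_coeff r W (a(i := Suc (a i))))))"
      by (simp add: signed_sum group_ring_mult_sum)
    also have "\<dots> = signed (q * Suc p) (A \<star> (gr_elem (word_prod r [hd W]) \<star> B
        + face_sum (\<otimes>) (\<lambda>v. comparison_coeff r v a) W + signed (Suc p) (comparison_coeff r (butlast W) a)))"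
      using Suc.IH[OF r(1) W(2) W(3)[unfolded p_def]] by (simp only: W(3,4) B_def)
    also have "A \<star> (gr_elem (word_prod r [hd W]) \<star> B) = c \<star> P \<star> B"
      using r closed by (simp add: A_def P_def V_W word_prod_append gr_elem_mult R.m_assoc)
    then have "A \<star> (gr_elem (word_prod r [hd W]) \<star> B
        + face_sum (\<otimes>) (\<lambda>v. comparison_coeff r v a) W + signed (Suc p) (comparison_coeff r (butlast W) a)) =
        c \<star> P \<star> B + A \<star> face_sum (\<otimes>) (\<lambda>v. comparison_coeff r v a) W + signed (Suc p) (A \<star> comparison_coeff r (butlast W) a)"
      by (simp only: group_ring_distrib_left group_ring_mult_signed)
    finally show ?thesis .
  qed
  have high: "signed p (cyclic_diff (Suc r) (Suc q) \<star> comparison_coeff (Suc r) w (a(Suc r := Suc q))) =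
      signed (q * p) (x \<star> P \<star> B + face_sum (\<otimes>) (word_coeff (Suc r)) V \<star> P \<star> B + signed (Suc q) (c \<star> P \<star> B))"
  proof -
    have "comparison_coeff r (drop (Suc q) w) (a(Suc r := Suc q)) = B"
      unfolding B_def by (rule comparison_coeff_cong) auto
    then have eq: "comparison_coeff (Suc r) w (a(Suc r := Suc q)) = signed (Suc q * p) (word_coeff (Suc r) V \<star> P \<star> B)"
      by (simp add: len V_def P_def)
    have "signed p (cyclic_diff (Suc r) (Suc q) \<star> comparison_coeff (Suc r) w (a(Suc r := Suc q))) =
        signed (q * p) (cyclic_diff (Suc r) (Suc q) \<star> (word_coeff (Suc r) V \<star> P \<star> B))"
      unfolding eq group_ring_mult_signed by (simp add: signed_def)
    also have "\<dots> = signed (q * p) (cyclic_diff (Suc r) (Suc q) \<star> word_coeff (Suc r) V \<star> P \<star> B)"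
      using r closed by (simp add: R.m_assoc)
    also have "cyclic_diff (Suc r) (Suc q) \<star> word_coeff (Suc r) V =
        x + face_sum (\<otimes>) (word_coeff (Suc r)) V + signed (Suc q) c"
      using word_coeff_boundary[of "Suc r" V] r V by (simp add: x_def c_def)
    finally show ?thesis
      by (simp only: group_ring_distrib_right group_ring_mult_signed)
  qed
  have first: "gr_elem (word_prod (Suc r) [hd w]) \<star> comparison_coeff (Suc r) (tl w) a = signed (q * p) (x \<star> P \<star> B)"
  proof -
    have "V = [hd w] @ tl V" using V by (cases V) auto
    then have P: "P = gr_elem (word_prod r [hd w]) \<star> gr_elem (word_prod r (tl V))"
      unfolding P_def by (metis gr_elem_mult r(1) word_prod_append)
    have "comparison_coeff (Suc r) (tl w) a =
        signed (q * p) (word_coeff (Suc r) (tl V) \<star> gr_elem (word_prod r (tl V)) \<star> B)"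
      by (simp add: Let_def len V B_def drop_Suc flip: q_def)
    then show ?thesis
      using r closed by (simp add: word_prod_Suc gr_elem_mult group_ring_mult_signed P x_def R.m_ac)
  qed
  have faces: "face_sum (\<otimes>) (\<lambda>v. comparison_coeff (Suc r) v a) w =
      signed (q * p) (face_sum (\<otimes>) (word_coeff (Suc r)) V \<star> P \<star> B + signed q (A \<star> face_sum (\<otimes>) (\<lambda>v. comparison_coeff r v a) W))"
  proof -
    let ?\<psi> = "\<lambda>v v'. word_coeff (Suc r) v \<star> gr_elem (word_prod r v) \<star> comparison_coeff r v' a"
    have "face_sum (\<otimes>) (\<lambda>v. comparison_coeff (Suc r) v a) w =
        face_sum (\<otimes>) (\<lambda>v. signed (q * p) (?\<psi> (take q v) (drop q v))) w"
      by (rule face_sum_cong) (simp_all add: Let_def length_merge len flip: q_def)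
    also have "\<dots> = signed (q * p) (face_sum (\<otimes>) (\<lambda>v. ?\<psi> (take q v) (drop q v)) w)"
      by (simp add: face_sum_def signed_sum signed_signed add.commute)
    also have "face_sum (\<otimes>) (\<lambda>v. ?\<psi> (take q v) (drop q v)) w =
        face_sum (\<otimes>) (\<lambda>v. ?\<psi> v (drop (Suc q) w)) V + signed q (face_sum (\<otimes>) (\<lambda>v. ?\<psi> (take q w) v) W)"
      using face_sum_split[of q w "(\<otimes>)" ?\<psi>] len by (simp add: V_def W_def)
    also have "face_sum (\<otimes>) (\<lambda>v. ?\<psi> v (drop (Suc q) w)) V = face_sum (\<otimes>) (\<lambda>v. word_coeff (Suc r) v \<star> P \<star> B) V"
      using r V by (intro face_sum_cong) (auto simp: P_def B_def word_prod_merge)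
    also have "\<dots> = face_sum (\<otimes>) (word_coeff (Suc r)) V \<star> P \<star> B"
      by (simp add: face_sum_mult)
    also have "face_sum (\<otimes>) (\<lambda>v. ?\<psi> (take q w) v) W = A \<star> face_sum (\<otimes>) (\<lambda>v. comparison_coeff r v a) W"
      by (simp add: face_sum_mult A_def c_def)
    finally show ?thesis .
  qed
  have last: "comparison_coeff (Suc r) (butlast w) a = signed (q * p) (A \<star> comparison_coeff r (butlast W) a)"
    using len by (simp add: Let_def A_def c_def W take_butlast flip: q_def)
  have "(\<Sum>i\<in>{1..Suc r}. signed (\<Sum>l\<in>{1..<i}. a l) (cyclic_diff i (Suc (a i)) \<star> comparison_coeff (Suc r) w (a(i := Suc (a i))))) =
      (\<Sum>i\<in>{1..r}. signed (\<Sum>l\<in>{1..<i}. a l) (cyclic_diff i (Suc (a i)) \<star> comparison_coeff (Suc r) w (a(i := Suc (a i)))))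
      + signed p (cyclic_diff (Suc r) (Suc q) \<star> comparison_coeff (Suc r) w (a(Suc r := Suc q)))"
    by (simp add: p_def q_def atLeastLessThanSuc_atLeastAtMost del: comparison_coeff.simps)
  then show ?case
    unfolding low high first faces last len sign_bookkeeping .
qed

end

section \<open>Free modules and linear extensions\<close>

lemma free_gr_module_carrier:
  "v \<in> carrier (free_gr_module G S) \<longleftrightarrow>
    Poly_Mapping.keys v \<subseteq> S \<and> (\<forall>s. Poly_Mapping.lookup v s \<in> carrier (group_ring G))"
  by (simp add: free_gr_module_def)

lemma free_gr_module_lookup: "v \<in> carrier (free_gr_module G S) \<Longrightarrow> Poly_Mapping.lookup v s \<in> carrier (group_ring G)"
  by (simp add: free_gr_module_carrier)

lemma free_gr_module_lookup_outside:
  "v \<in> carrier (free_gr_module G S) \<Longrightarrow> s \<notin> S \<Longrightarrow> Poly_Mapping.lookup v s = 0"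
  by (auto simp: free_gr_module_carrier in_keys_iff)

lemma lookup_gr_smult [simp]:
  "Poly_Mapping.lookup (gr_smult G r v) s = r \<otimes>\<^bsub>group_ring G\<^esub> Poly_Mapping.lookup v s"
  by (simp add: free_gr_module_def Poly_Mapping.map.rep_eq when_def)

lemma gr_smult_distrib:
  "gr_smult G r (v + w) = gr_smult G r v + gr_smult G r w"
  "gr_smult G (r + r') v = gr_smult G r v + gr_smult G r' v"
  by (rule poly_mapping_eqI; simp add: lookup_add group_ring_distrib_left group_ring_distrib_right)+

lemma gr_smult_zero [simp]: "gr_smult G 0 v = 0" "gr_smult G r 0 = 0"
  by (rule poly_mapping_eqI; simp)+

lemma linear_extension_expand:
  assumes "finite A" "Poly_Mapping.keys v \<subseteq> A"
  shows "linear_extension G f v = (\<Sum>s\<in>A. gr_smult G (Poly_Mapping.lookup v s) (f s))"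
  unfolding linear_extension_def using assms
  by (intro sum.mono_neutral_left) (auto simp: in_keys_iff)

lemma lookup_linear_extension:
  assumes "finite A" "Poly_Mapping.keys v \<subseteq> A"
  shows "Poly_Mapping.lookup (linear_extension G f v) t =
    (\<Sum>s\<in>A. Poly_Mapping.lookup v s \<otimes>\<^bsub>group_ring G\<^esub> Poly_Mapping.lookup (f s) t)"
  by (simp add: linear_extension_expand[OF assms] lookup_sum)

lemma linear_extension_zero [simp]: "linear_extension G f 0 = 0"
  by (simp add: linear_extension_def)

lemma linear_extension_add: "linear_extension G f (v + w) = linear_extension G f v + linear_extension G f w"
proof -
  let ?A = "Poly_Mapping.keys v \<union> Poly_Mapping.keys w"
  have "Poly_Mapping.keys (v + w) \<subseteq> ?A" by (rule keys_add)
  then show ?thesis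
    by (simp add: linear_extension_expand[of ?A] lookup_add gr_smult_distrib sum.distrib)
qed

lemma linear_extension_sum: "linear_extension G f (\<Sum>i\<in>I. v i) = (\<Sum>i\<in>I. linear_extension G f (v i))"
  by (induction I rule: infinite_finite_induct) (simp_all add: linear_extension_add)

lemma free_gr_module_zero [simp]: "0 \<in> carrier (free_gr_module G S)"
  by (simp add: free_gr_module_carrier)

lemma free_gr_module_add [simp]:
  "v \<in> carrier (free_gr_module G S) \<Longrightarrow> w \<in> carrier (free_gr_module G S) \<Longrightarrow> v + w \<in> carrier (free_gr_module G S)"
  using keys_add[of v w] by (auto simp: free_gr_module_carrier lookup_add)

lemma free_gr_module_sum [simp]:
  "(\<And>i. i \<in> I \<Longrightarrow> f i \<in> carrier (free_gr_module G S)) \<Longrightarrow> (\<Sum>i\<in>I. f i) \<in> carrier (free_gr_module G S)"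
  by (induction I rule: infinite_finite_induct) simp_all

context comm_group
begin

interpretation R: cring "group_ring G" by (rule group_ring_cring)

lemma free_gr_module_smult [simp]:
  assumes "r \<in> carrier (group_ring G)" "v \<in> carrier (free_gr_module G S)"
  shows "gr_smult G r v \<in> carrier (free_gr_module G S)"
  using assms by (auto simp: free_gr_module_carrier in_keys_iff) (metis group_ring_mult_zero(2) in_keys_iff subsetD)

lemma gen_closed [simp]: "s \<in> S \<Longrightarrow> gen G s \<in> carrier (free_gr_module G S)"
  by (auto simp: gen_def free_gr_module_carrier lookup_single when_def)

lemma linear_extension_closed:
  assumes "v \<in> carrier (free_gr_module G S)" "\<And>s. s \<in> S \<Longrightarrow> f s \<in> carrier (free_gr_module G T)"
  shows "linear_extension G f v \<in> carrier (free_gr_module G T)"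
  unfolding linear_extension_def using assms
  by (intro free_gr_module_sum free_gr_module_smult) (auto simp: free_gr_module_carrier)

lemma linear_extension_smult:
  assumes "r \<in> carrier (group_ring G)" "v \<in> carrier (free_gr_module G S)"
    "\<And>s. s \<in> S \<Longrightarrow> f s \<in> carrier (free_gr_module G T)"
  shows "linear_extension G f (gr_smult G r v) = gr_smult G r (linear_extension G f v)"
proof (rule poly_mapping_eqI)
  fix t
  have "Poly_Mapping.keys (gr_smult G r v) \<subseteq> Poly_Mapping.keys v"
    by (auto simp: in_keys_iff)
  then have "Poly_Mapping.lookup (linear_extension G f (gr_smult G r v)) t =
      (\<Sum>s\<in>Poly_Mapping.keys v. r \<otimes>\<^bsub>group_ring G\<^esub> Poly_Mapping.lookup v s \<otimes>\<^bsub>group_ring G\<^esub> Poly_Mapping.lookup (f s) t)"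
    by (simp add: lookup_linear_extension[of "Poly_Mapping.keys v"])
  also have "\<dots> = (\<Sum>s\<in>Poly_Mapping.keys v. r \<otimes>\<^bsub>group_ring G\<^esub> (Poly_Mapping.lookup v s \<otimes>\<^bsub>group_ring G\<^esub> Poly_Mapping.lookup (f s) t))"
  proof (rule sum.cong)
    fix s assume "s \<in> Poly_Mapping.keys v"
    then have "f s \<in> carrier (free_gr_module G T)"
      using assms by (auto simp: free_gr_module_carrier)
    then show "r \<otimes>\<^bsub>group_ring G\<^esub> Poly_Mapping.lookup v s \<otimes>\<^bsub>group_ring G\<^esub> Poly_Mapping.lookup (f s) t =
        r \<otimes>\<^bsub>group_ring G\<^esub> (Poly_Mapping.lookup v s \<otimes>\<^bsub>group_ring G\<^esub> Poly_Mapping.lookup (f s) t)"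
      using assms by (intro R.m_assoc) (auto simp: free_gr_module_carrier)
  qed simp
  also have "\<dots> = Poly_Mapping.lookup (gr_smult G r (linear_extension G f v)) t"
    by (simp add: lookup_linear_extension[of "Poly_Mapping.keys v"] group_ring_mult_sum)
  finally show "Poly_Mapping.lookup (linear_extension G f (gr_smult G r v)) t =
      Poly_Mapping.lookup (gr_smult G r (linear_extension G f v)) t" .
qed

lemma linear_extension_gen:
  assumes "f s \<in> carrier (free_gr_module G T)"
  shows "linear_extension G f (gen G s) = f s"
  by (rule poly_mapping_eqI)
    (use assms in \<open>simp add: lookup_linear_extension[of "{s}"] gen_def free_gr_module_lookup\<close>)

lemma linear_extension_hom:
  assumes "\<And>s. s \<in> S \<Longrightarrow> f s \<in> carrier (free_gr_module G T)"
  shows "linear_extension G f \<in> module_homs (group_ring G) (free_gr_module G S) (free_gr_module G T)"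
  unfolding module_homs_def
proof (intro CollectI conjI ballI Pi_I)
  show "linear_extension G f v \<in> carrier (free_gr_module G T)" if "v \<in> carrier (free_gr_module G S)" for v
    using that assms by (rule linear_extension_closed)
  show "linear_extension G f (r \<odot>\<^bsub>free_gr_module G S\<^esub> v) = r \<odot>\<^bsub>free_gr_module G T\<^esub> linear_extension G f v"
    if "r \<in> carrier (group_ring G)" "v \<in> carrier (free_gr_module G S)" for r v
    using linear_extension_smult[OF that assms] by (simp add: free_gr_module_def)
qed (simp add: free_gr_module_def linear_extension_add)

lemma linear_extension_compose:
  assumes "v \<in> carrier (free_gr_module G S)"
    "\<And>s. s \<in> S \<Longrightarrow> f s \<in> carrier (free_gr_module G T)"
    "\<And>t. t \<in> T \<Longrightarrow> f' t \<in> carrier (free_gr_module G U)"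
  shows "linear_extension G f' (linear_extension G f v) = linear_extension G (\<lambda>s. linear_extension G f' (f s)) v"
proof -
  have "linear_extension G f' (linear_extension G f v) =
      (\<Sum>s\<in>Poly_Mapping.keys v. linear_extension G f' (gr_smult G (Poly_Mapping.lookup v s) (f s)))"
    by (simp add: linear_extension_def[of G f v] linear_extension_sum)
  also have "\<dots> = (\<Sum>s\<in>Poly_Mapping.keys v. gr_smult G (Poly_Mapping.lookup v s) (linear_extension G f' (f s)))"
  proof (intro sum.cong refl linear_extension_smult[OF _ _ assms(3)])
    fix s assume "s \<in> Poly_Mapping.keys v"
    then show "f s \<in> carrier (free_gr_module G T)"
      using assms(1) by (intro assms(2)) (auto simp: free_gr_module_carrier)
  qed (use assms(1) in \<open>auto simp: free_gr_module_lookup\<close>)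
  also have "\<dots> = linear_extension G (\<lambda>s. linear_extension G f' (f s)) v"
    by (simp add: linear_extension_def)
  finally show ?thesis .
qed

end

section \<open>The Koszul differential in coefficients\<close>

context cyclic_decomposition
begin

interpretation R: cring "group_ring G" by (rule group_ring_cring)

definition koszul_indices :: "nat \<Rightarrow> (nat \<Rightarrow> nat) set" where
  "koszul_indices k = {a. (\<forall>i. i \<notin> {1..n} \<longrightarrow> a i = 0) \<and> (\<Sum>i\<in>{1..n}. a i) = k}"

lemma koszul_module_eq: "koszul_module G n k = free_gr_module G (koszul_indices k)"
  by (simp add: koszul_module_def koszul_indices_def)

lemma lookup_koszul_diff_part:
  assumes "i \<in> {1..n}"
  shows "Poly_Mapping.lookup (koszul_diff_part G g m i b) a =
    (if b = a(i := Suc (a i)) then signed (\<Sum>l\<in>{1..<i}. a l) (cyclic_diff i (Suc (a i))) else 0)"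
proof -
  have "b i \<noteq> 0 \<and> b(i := b i - 1) = a \<longleftrightarrow> b = a(i := Suc (a i))"
    by (auto simp: fun_eq_iff)
  moreover have "(\<Sum>l\<in>{1..<i}. (a(i := Suc (a i))) l) = (\<Sum>l\<in>{1..<i}. a l)"
    by (rule sum.cong) auto
  ultimately show ?thesis
    using assms by (auto simp: koszul_diff_part_def gen_def lookup_single when_def gr_int_sign_mult
        cyclic_diff_def group_ring_mult_signed)
qed

text \<open>
  The generator with index \<open>a\<close> is hit exactly by the generators whose index exceeds \<open>a\<close> by 1 in one place,
  so each direction contributes one summand.
\<close>

lemma lookup_koszul_diff:
  assumes "\<And>s. Poly_Mapping.lookup v s \<in> RC"
  shows "Poly_Mapping.lookup (koszul_diff G g m n v) a =
    (\<Sum>i\<in>{1..n}. signed (\<Sum>l\<in>{1..<i}. a l) (cyclic_diff i (Suc (a i)) \<star> Poly_Mapping.lookup v (a(i := Suc (a i)))))"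
proof -
  let ?K = "Poly_Mapping.keys v"
  have "Poly_Mapping.lookup (koszul_diff G g m n v) a =
      (\<Sum>b\<in>?K. \<Sum>i\<in>{1..n}. Poly_Mapping.lookup v b \<star> Poly_Mapping.lookup (koszul_diff_part G g m i b) a)"
    by (simp add: koszul_diff_def lookup_linear_extension[of ?K] lookup_sum group_ring_mult_sum)
  also have "\<dots> = (\<Sum>i\<in>{1..n}. \<Sum>b\<in>?K. Poly_Mapping.lookup v b \<star> Poly_Mapping.lookup (koszul_diff_part G g m i b) a)"
    by (rule sum.swap)
  also have "\<dots> = (\<Sum>i\<in>{1..n}. signed (\<Sum>l\<in>{1..<i}. a l) (cyclic_diff i (Suc (a i)) \<star> Poly_Mapping.lookup v (a(i := Suc (a i)))))"
  proof (rule sum.cong)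
    fix i assume i: "i \<in> {1..n}"
    let ?b = "a(i := Suc (a i))" and ?d = "signed (\<Sum>l\<in>{1..<i}. a l) (cyclic_diff i (Suc (a i)))"
    have "(\<Sum>b\<in>?K. Poly_Mapping.lookup v b \<star> Poly_Mapping.lookup (koszul_diff_part G g m i b) a) =
        (\<Sum>b\<in>?K. if b = ?b then Poly_Mapping.lookup v b \<star> ?d else 0)"
      using i by (intro sum.cong) (simp_all add: lookup_koszul_diff_part)
    also have "\<dots> = Poly_Mapping.lookup v ?b \<star> ?d"
      by (simp add: in_keys_iff)
    finally show "(\<Sum>b\<in>?K. Poly_Mapping.lookup v b \<star> Poly_Mapping.lookup (koszul_diff_part G g m i b) a) =
        signed (\<Sum>l\<in>{1..<i}. a l) (cyclic_diff i (Suc (a i)) \<star> Poly_Mapping.lookup v ?b)"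
      using i assms by (simp add: group_ring_mult_signed R.m_comm)
  qed simp
  finally show ?thesis .
qed

lemma koszul_diff_part_closed:
  assumes "i \<in> {1..n}" "b \<in> koszul_indices k"
  shows "koszul_diff_part G g m i b \<in> carrier (koszul_module G n (k - 1))"
proof (cases "b i = 0")
  case False
  have "(\<Sum>j\<in>{1..n}. (b(i := b i - 1)) j) = b i - 1 + (\<Sum>j\<in>{1..n} - {i}. b j)"
    using assms(1) by (simp add: sum.remove[of _ i])
  also have "\<dots> = (\<Sum>j\<in>{1..n}. b j) - 1"
    using assms(1) False by (simp add: sum.remove[of _ i])
  finally have "b(i := b i - 1) \<in> koszul_indices (k - 1)"
    using assms by (auto simp: koszul_indices_def)
  then show ?thesis
    using assms(1) by (auto simp: koszul_diff_part_def koszul_module_eq gr_int_sign_mult)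
qed (simp add: koszul_diff_part_def koszul_module_eq)

end

section \<open>Indices of the comparison formula\<close>

lemma finite_increasing_tuples: "finite (increasing_tuples l n)"
  unfolding increasing_tuples_def by (rule finite_subset[OF _ finite_PiE[of "{1..l}" "\<lambda>_. {1..n}"]]) auto

lemma finite_compositions: "finite (compositions l k)"
  unfolding compositions_def by (rule finite_subset[OF _ finite_PiE[of "{1..l}" "\<lambda>_. {1..k}"]]) auto

text \<open>
  An increasing tuple is determined by its range, as the sorted enumeration of that set.
\<close>

lemma increasing_tuples_sorted:
  assumes "r \<in> increasing_tuples l n"
  shows "map r [1..<Suc l] = sorted_list_of_set (r ` {1..l})"
proof -
  have "strict_mono_on {1..l} r" using assms by (simp add: increasing_tuples_def)
  then have "sorted_wrt (<) (map r [1..<Suc l])"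
    by (auto simp: sorted_wrt_map sorted_wrt_iff_nth_less strict_mono_on_def simp del: upt_Suc)
  then show ?thesis
    by (intro sorted_distinct_set_unique) (auto simp: strict_sorted_iff)
qed

lemma sum_place:
  assumes "finite S"
  shows "(\<Sum>j\<in>S. place l r lam j * f j) = (\<Sum>u\<in>{u \<in> {1..l}. r u \<in> S}. lam u * f (r u))"
proof -
  have "(\<Sum>j\<in>S. place l r lam j * f j) = (\<Sum>j\<in>S. \<Sum>u\<in>{1..l}. if r u = j then lam u * f j else 0)"
    by (simp only: place_def sum_distrib_right sum.inter_filter finite_atLeastAtMost) (auto intro!: sum.cong)
  also have "\<dots> = (\<Sum>u\<in>{1..l}. \<Sum>j\<in>S. if r u = j then lam u * f j else 0)"
    by (rule sum.swap)
  also have "\<dots> = (\<Sum>u\<in>{u \<in> {1..l}. r u \<in> S}. lam u * f (r u))"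
    using assms by (simp only: sum.inter_filter finite_atLeastAtMost sum.delta sum.delta' cong: if_cong)
  finally show ?thesis .
qed

lemma sum_place':
  assumes "finite S"
  shows "(\<Sum>j\<in>S. place l r lam j) = (\<Sum>u\<in>{u \<in> {1..l}. r u \<in> S}. lam u)"
  using sum_place[OF assms, of l r lam "\<lambda>_. 1"] by simp

context
  fixes l n k :: nat and r lam :: "nat \<Rightarrow> nat"
  assumes r: "r \<in> increasing_tuples l n" and lam: "lam \<in> compositions l k"
begin

lemma increasing_tuples_less_iff: "u \<in> {1..l} \<Longrightarrow> v \<in> {1..l} \<Longrightarrow> r u < r v \<longleftrightarrow> u < v"
  using r strict_mono_on_less[of "{1..l}" r u v] by (auto simp: increasing_tuples_def)

lemma increasing_tuples_inj: "inj_on r {1..l}"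
  using r by (auto simp: increasing_tuples_def intro: strict_mono_on_imp_inj_on)

lemma increasing_tuples_range: "u \<in> {1..l} \<Longrightarrow> r u \<in> {1..n}"
  using r by (auto simp: increasing_tuples_def)

lemma place_at: "u \<in> {1..l} \<Longrightarrow> place l r lam (r u) = lam u"
proof -
  assume u: "u \<in> {1..l}"
  then have "{v \<in> {1..l}. r v = r u} = {u}"
    using inj_on_eq_iff[OF increasing_tuples_inj] by blast
  then show ?thesis by (simp add: place_def)
qed

lemma place_support: "{j. place l r lam j \<noteq> 0} = r ` {1..l}"
proof -
  have inside: "place l r lam (r u) \<noteq> 0" if "u \<in> {1..l}" for u
  proof -
    have "lam u \<in> {1..k}" using lam that by (auto simp: compositions_def dest: PiE_mem)
    then show ?thesis using place_at[OF that] by simp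
  qed
  have outside: "place l r lam j = 0" if "j \<notin> r ` {1..l}" for j
    using that unfolding place_def by (intro sum.neutral) auto
  show ?thesis
  proof (intro equalityI subsetI)
    show "j \<in> r ` {1..l}" if "j \<in> {j. place l r lam j \<noteq> 0}" for j
      using that outside[of j] by (cases "j \<in> r ` {1..l}") auto
    show "j \<in> {j. place l r lam j \<noteq> 0}" if "j \<in> r ` {1..l}" for j
      using that inside by (elim imageE) (simp only: mem_Collect_eq not_False_eq_True)
  qed
qed

lemma place_koszul: "(\<forall>j. j \<notin> {1..n} \<longrightarrow> place l r lam j = 0) \<and> (\<Sum>j\<in>{1..n}. place l r lam j) = k"
proof -
  have "{u \<in> {1..l}. r u \<in> {1..n}} = {1..l}" using increasing_tuples_range by auto
  then have "(\<Sum>j\<in>{1..n}. place l r lam j) = k"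
    using lam by (simp add: sum_place' compositions_def)
  moreover have "place l r lam j = 0" if "j \<notin> {1..n}" for j
  proof -
    have "j \<notin> r ` {1..l}" using that increasing_tuples_range by (metis imageE)
    then show ?thesis unfolding place_support[symmetric] by simp
  qed
  ultimately show ?thesis by blast
qed

text \<open>
  The bounds of the intervals in the comparison formula are partial sums of \<open>\<lambda>\<close> from above. In
  terms of the index \<open>a\<close> they are partial sums over all later factors, since factors that are not among
  the \<open>r\<^sub>i\<close> contribute 0.
\<close>

lemma sum_place_above:
  assumes "u \<in> {1..l}"
  shows "(\<Sum>j\<in>{r u<..n}. place l r lam j) = (\<Sum>v\<in>{u<..l}. lam v)"
proof -
  have "{v \<in> {1..l}. r v \<in> {r u<..n}} = {u<..l}"
    using assms increasing_tuples_range increasing_tuples_less_iff[OF assms] by auto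
  then show ?thesis by (simp add: sum_place')
qed

lemma sum_place_pairs:
  "(\<Sum>i\<in>{1..n}. \<Sum>j\<in>{i<..n}. place l r lam i * place l r lam j) = (\<Sum>i\<in>{1..l}. \<Sum>j\<in>{i<..l}. lam i * lam j)"
proof -
  have "{u \<in> {1..l}. r u \<in> {1..n}} = {1..l}" using increasing_tuples_range by auto
  then show ?thesis
    by (simp add: sum_place sum_place_above flip: sum_distrib_left)
qed

end

text \<open>
  The \<open>r\<^sub>i\<close> enumerate the support of the index increasingly, and the \<open>\<lambda>\<^sub>i\<close> are its values there.
\<close>

lemma place_inject:
  assumes r: "r \<in> increasing_tuples l n" "r' \<in> increasing_tuples l' n"
    and lam: "lam \<in> compositions l k" "lam' \<in> compositions l' k"
    and eq: "place l r lam = place l' r' lam'"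
  shows "l = l' \<and> r = r' \<and> lam = lam'"
proof -
  have supp: "r ` {1..l} = r' ` {1..l'}"
    using place_support[OF r(1) lam(1)] place_support[OF r(2) lam(2)] eq by simp
  then have maps: "map r [1..<Suc l] = map r' [1..<Suc l']"
    using increasing_tuples_sorted[OF r(1)] increasing_tuples_sorted[OF r(2)] by simp
  then have l: "l = l'" using map_eq_imp_length_eq[OF maps] by (simp only: length_upt)
  have agree: "r u = r' u" if "u \<in> {1..l}" for u
    using maps that unfolding l map_eq_conv by (simp del: upt_Suc)
  then have "r = r'"
    using r l agree by (intro PiE_ext[of r "{1..l}" "\<lambda>_. {1..n}" r']) (auto simp: increasing_tuples_def)
  moreover have lam_agree: "lam u = lam' u" if "u \<in> {1..l}" for u
    using place_at[OF r(1) lam(1)] place_at[OF r(2) lam(2)] that l eq agree by metis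
  then have "lam = lam'"
    using lam l lam_agree by (intro PiE_ext[of lam "{1..l}" "\<lambda>_. {1..k}" lam']) (auto simp: compositions_def)
  ultimately show ?thesis using l by simp
qed

lemma place_surj:
  assumes "\<forall>i. i \<notin> {1..n} \<longrightarrow> a i = 0" "(\<Sum>i\<in>{1..n}. a i) = k" "k \<ge> 1"
  obtains l r lam where "l \<in> {1..k}" "r \<in> increasing_tuples l n" "lam \<in> compositions l k" "a = place l r lam"
proof -
  define S where "S = {j. a j \<noteq> 0}"
  have "S \<subseteq> {1..n}" using assms(1) by (auto simp: S_def)
  then have S: "S \<subseteq> {1..n}" "finite S" by (auto intro: finite_subset)
  define l where "l = card S"
  define xs where "xs = sorted_list_of_set S"
  have xs: "set xs = S" "length xs = l" "sorted_wrt (<) xs"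
    using S by (simp_all add: xs_def l_def)
  define r where "r = (\<lambda>u\<in>{1..l}. xs ! (u - 1))"
  define lam where "lam = (\<lambda>u\<in>{1..l}. a (r u))"
  have r_S: "r u \<in> S" if "u \<in> {1..l}" for u
    using that xs by (auto simp: r_def intro: nth_mem)
  have r: "r \<in> increasing_tuples l n"
    unfolding increasing_tuples_def
  proof (intro CollectI conjI)
    show "r \<in> {1..l} \<rightarrow>\<^sub>E {1..n}" using r_S S by (auto simp: r_def)
    show "strict_mono_on {1..l} r"
      using xs(2) by (auto simp: strict_mono_on_def r_def intro!: sorted_wrt_nth_less[OF xs(3)])
  qed
  have image: "r ` {1..l} = S"
  proof (intro card_subset_eq[OF S(2)])
    show "card (r ` {1..l}) = card S"
      using card_image[of r "{1..l}"] r l_def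
      by (auto simp: increasing_tuples_def dest: strict_mono_on_imp_inj_on)
  qed (use r_S in auto)
  have inj: "inj_on r {1..l}"
    using r by (auto simp: increasing_tuples_def intro: strict_mono_on_imp_inj_on)
  have sum_lam: "(\<Sum>u\<in>{1..l}. lam u) = k"
  proof -
    have "(\<Sum>u\<in>{1..l}. lam u) = (\<Sum>u\<in>{1..l}. a (r u))" by (simp add: lam_def)
    also have "\<dots> = (\<Sum>j\<in>S. a j)" using sum.reindex[OF inj, of a] image by simp
    also have "\<dots> = (\<Sum>j\<in>{1..n}. a j)" using S by (intro sum.mono_neutral_left) (auto simp: S_def)
    finally show ?thesis using assms(2) by simp
  qed
  have lam_le: "lam u \<in> {1..k}" if "u \<in> {1..l}" for u
    using that r_S[OF that] member_le_sum[of u "{1..l}" lam] sum_lam by (auto simp: lam_def S_def)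
  have lam: "lam \<in> compositions l k"
    using lam_le sum_lam by (auto simp: compositions_def lam_def)
  have "l = (\<Sum>u\<in>{1..l}. 1)" by simp
  also have "\<dots> \<le> (\<Sum>u\<in>{1..l}. lam u)"
    using lam_le by (intro sum_mono) auto
  finally have "l \<le> k" using sum_lam by simp
  moreover have "l \<noteq> 0" using sum_lam assms(3) by (cases "l = 0") simp_all
  ultimately have "l \<in> {1..k}" by simp
  moreover have "a = place l r lam"
  proof
    fix j
    show "a j = place l r lam j"
    proof (cases "j \<in> S")
      case True
      then obtain u where "u \<in> {1..l}" "j = r u" using image by auto
      then show ?thesis using place_at[OF r lam] by (simp add: lam_def)
    next
      case False
      then have "a j = 0" "j \<notin> {j. place l r lam j \<noteq> 0}"
        using place_support[OF r lam] image by (simp_all only: S_def mem_Collect_eq not_not)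
      then show ?thesis by simp
    qed
  qed
  ultimately show thesis using that r lam by blast
qed

section \<open>The comparison formula in terms of comparison coefficients\<close>

text \<open>
  The pairs are listed from the end of the word, as in the products of integer parts in \<open>\<xi>\<close>.
\<close>

lemma carries_prod:
  assumes "length v = 2 * h"
  shows "carries m v = int (\<Prod>t<h. (v ! (2 * h - 1 - 2 * t) + v ! (2 * h - 2 - 2 * t)) div m)"
proof -
  have "carries m v = int (\<Prod>t<h. (v ! (2 * t + 1) + v ! (2 * t)) div m)"
    using assms
  proof (induction h arbitrary: v)
    case (Suc h)
    then obtain x y s where v: "v = x # y # s" by (auto simp: length_Suc_conv)
    have "carries m v = int ((v ! 1 + v ! 0) div m) * int (\<Prod>t<h. (v ! (2 * Suc t + 1) + v ! (2 * Suc t)) div m)"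
      using Suc by (simp add: v add.commute)
    then show ?case by (simp add: prod.lessThan_Suc_shift del: prod.lessThan_Suc)
  qed simp
  also have "(\<Prod>t<h. (v ! (2 * t + 1) + v ! (2 * t)) div m) =
      (\<Prod>t<h. (v ! (2 * (h - Suc t) + 1) + v ! (2 * (h - Suc t))) div m)"
    by (rule prod.nat_diff_reindex[symmetric])
  also have "\<dots> = (\<Prod>t<h. (v ! (2 * h - 1 - 2 * t) + v ! (2 * h - 2 - 2 * t)) div m)"
  proof (rule prod.cong)
    fix t assume "t \<in> {..<h}"
    then have "2 * (h - Suc t) + 1 = 2 * h - 1 - 2 * t" "2 * (h - Suc t) = 2 * h - 2 - 2 * t" by auto
    then show "(v ! (2 * (h - Suc t) + 1) + v ! (2 * (h - Suc t))) div m =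
        (v ! (2 * h - 1 - 2 * t) + v ! (2 * h - 2 - 2 * t)) div m" by simp
  qed simp
  finally show ?thesis .
qed

context cyclic_decomposition
begin

interpretation R: cring "group_ring G" by (rule group_ring_cring)

definition segment :: "nat \<Rightarrow> (nat \<Rightarrow> nat) \<Rightarrow> 'a list \<Rightarrow> nat \<Rightarrow> 'a list" where
  "segment r a w j = take (a j) (drop (\<Sum>i\<in>{j<..r}. a i) w)"

text \<open>
  The contribution of factor \<open>j\<close>. The segments of the factors cut \<open>w\<close> into consecutive pieces, with
  the segment of the last factor first.
\<close>

definition block :: "nat \<Rightarrow> (nat \<Rightarrow> nat) \<Rightarrow> 'a list \<Rightarrow> nat \<Rightarrow> 'a \<Rightarrow>\<^sub>0 int" where
  "block r a w j = word_coeff j (segment r a w j) \<star> gr_elem (word_prod (j - 1) (segment r a w j))"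

lemma block_closed [simp]: "j \<in> {1..n} \<Longrightarrow> block r a w j \<in> RC"
  by (auto simp: block_def)

lemma block_empty: "a j = 0 \<Longrightarrow> block r a w j = Poly_Mapping.single \<one> 1"
  by (simp add: block_def segment_def word_coeff_def cyclic_coeff_def word_prod_def gr_elem_one gr_int_one)

lemma comparison_coeff_closed_form:
  assumes "r \<le> n" "length w = (\<Sum>j\<in>{1..r}. a j)"
  shows "comparison_coeff r w a =
    signed (\<Sum>i\<in>{1..r}. \<Sum>j\<in>{i<..r}. a i * a j) (\<Otimes>\<^bsub>group_ring G\<^esub>j\<in>{1..r}. block r a w j)"
  using assms
proof (induction r arbitrary: w)
  case (Suc r)
  define q where "q = a (Suc r)"
  have r: "r \<le> n" "Suc r \<in> {1..n}" using Suc.prems by auto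
  have above: "{j<..Suc r} = insert (Suc r) {j<..r}" if "j \<in> {1..r}" for j using that by auto
  have seg: "segment (Suc r) a w j = segment r a (drop q w) j" if "j \<in> {1..r}" for j
    using that by (simp add: segment_def above q_def add.commute)
  have top: "segment (Suc r) a w (Suc r) = take q w"
    by (simp add: segment_def q_def)
  have len: "length (drop q w) = (\<Sum>j\<in>{1..r}. a j)" using Suc.prems(2) by (simp add: q_def)
  have prod: "(\<Otimes>\<^bsub>group_ring G\<^esub>j\<in>{1..Suc r}. block (Suc r) a w j) =
      block (Suc r) a w (Suc r) \<star> (\<Otimes>\<^bsub>group_ring G\<^esub>j\<in>{1..r}. block r a (drop q w) j)"
  proof -
    have "{1..Suc r} = insert (Suc r) {1..r}" by auto
    moreover have "(\<Otimes>\<^bsub>group_ring G\<^esub>j\<in>{1..r}. block (Suc r) a w j) =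
        (\<Otimes>\<^bsub>group_ring G\<^esub>j\<in>{1..r}. block r a (drop q w) j)"
      using r by (intro R.finprod_cong') (auto simp: block_def seg)
    ultimately show ?thesis
      using r by (simp add: Pi_def)
  qed
  have signs: "(\<Sum>i\<in>{1..Suc r}. \<Sum>j\<in>{i<..Suc r}. a i * a j) =
      (\<Sum>i\<in>{1..r}. \<Sum>j\<in>{i<..r}. a i * a j) + q * (length w - q)"
  proof -
    have "(\<Sum>i\<in>{1..Suc r}. \<Sum>j\<in>{i<..Suc r}. a i * a j) = (\<Sum>i\<in>{1..r}. (\<Sum>j\<in>{i<..r}. a i * a j) + q * a i)"
      by (simp add: above q_def ac_simps)
    also have "\<dots> = (\<Sum>i\<in>{1..r}. \<Sum>j\<in>{i<..r}. a i * a j) + q * (\<Sum>i\<in>{1..r}. a i)"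
      by (simp add: sum.distrib sum_distrib_left)
    finally show ?thesis using len by simp
  qed
  have "comparison_coeff (Suc r) w a = signed (q * (length w - q))
      (block (Suc r) a w (Suc r) \<star> comparison_coeff r (drop q w) a)"
    by (simp add: Let_def block_def top flip: q_def)
  also have "\<dots> = signed (\<Sum>i\<in>{1..Suc r}. \<Sum>j\<in>{i<..Suc r}. a i * a j)
      (\<Otimes>\<^bsub>group_ring G\<^esub>j\<in>{1..Suc r}. block (Suc r) a w j)"
    unfolding signs prod Suc.IH[OF r(1) len] group_ring_mult_signed signed_signed by (simp add: add.commute)
  finally show ?case .
qed simp

text \<open>
  The interval \<open>[s + 1, s + L]\<close> of positions is the piece of the word after its first \<open>s\<close> letters. For odd
  \<open>L\<close> the unpaired index is the first one, which is why \<open>cyclic_coeff\<close> splits off the head.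
\<close>

lemma xi_segment:
  assumes r: "r \<in> {1..n}" and L: "L \<ge> 1" "s + L \<le> length w"
  shows "xi G g m (\<lambda>u. expo (w ! (u - 1))) r (s + 1) (s + L) =
    word_coeff r (take L (drop s w)) \<star> gr_elem (word_prod (r - 1) (take L (drop s w)))"
proof -
  let ?v = "take L (drop s w)"
  let ?e = "map (\<lambda>h. expo h r) ?v"
  let ?\<alpha> = "\<lambda>u. expo (w ! (u - 1))"
  have len: "length ?v = L" using L by simp
  have nth: "?e ! i = ?\<alpha> (s + 1 + i) r" if "i < L" for i
    using that L by simp
  have "(\<Sum>u\<in>{s + 1..s + L}. ?\<alpha> u j) = sum_list (map (\<lambda>h. expo h j) ?v)" for j
  proof -
    have "sum_list (map (\<lambda>h. expo h j) ?v) = (\<Sum>i<L. expo (w ! (s + i)) j)"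
      using L by (simp add: sum_list_sum_nth atLeast0LessThan)
    also have "\<dots> = (\<Sum>u\<in>{s + 1..s + L}. ?\<alpha> u j)"
      by (rule sum.reindex_bij_witness[of _ "\<lambda>u. u - s - 1" "\<lambda>i. s + 1 + i"]) auto
    finally show ?thesis by simp
  qed
  then have group_part: "(\<Otimes>j\<in>{1..<r}. g j [^] (\<Sum>u\<in>{s + 1..s + L}. ?\<alpha> u j)) = word_prod (r - 1) ?v"
    using r unfolding word_prod_def by (intro finprod_cong') auto
  have carry_part: "word_coeff r ?v =
      gr_int G (int (\<Prod>t<L div 2. (?\<alpha> (s + L - 2 * t) r + ?\<alpha> (s + L - 2 * t - 1) r) div m r)) \<star>
      (if even (L - 1) then gr_partial G g r (?\<alpha> (s + 1) r) else Poly_Mapping.single \<one> 1)"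
  proof (cases "even L")
    case True
    then obtain h where h: "L = 2 * h" by auto
    have "carries (m r) ?e = int (\<Prod>t<h. (?e ! (2 * h - 1 - 2 * t) + ?e ! (2 * h - 2 - 2 * t)) div m r)"
      using len h by (intro carries_prod) simp
    also have "(\<Prod>t<h. (?e ! (2 * h - 1 - 2 * t) + ?e ! (2 * h - 2 - 2 * t)) div m r) =
        (\<Prod>t<h. (?\<alpha> (s + L - 2 * t) r + ?\<alpha> (s + L - 2 * t - 1) r) div m r)"
    proof (rule prod.cong)
      fix t assume "t \<in> {..<h}"
      then have "s + 1 + (2 * h - 1 - 2 * t) = s + L - 2 * t" "s + 1 + (2 * h - 2 - 2 * t) = s + L - 2 * t - 1"
        "2 * h - 1 - 2 * t < L" "2 * h - 2 - 2 * t < L"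
        using h by auto
      then show "(?e ! (2 * h - 1 - 2 * t) + ?e ! (2 * h - 2 - 2 * t)) div m r =
          (?\<alpha> (s + L - 2 * t) r + ?\<alpha> (s + L - 2 * t - 1) r) div m r"
        by (simp only: nth)
    qed simp
    finally show ?thesis
      using h L len by (simp add: word_coeff_def cyclic_coeff_def)
  next
    case False
    then obtain h where h: "L = 2 * h + 1" by (auto elim: oddE)
    have "carries (m r) (tl ?e) = int (\<Prod>t<h. (tl ?e ! (2 * h - 1 - 2 * t) + tl ?e ! (2 * h - 2 - 2 * t)) div m r)"
      using len h by (intro carries_prod) simp
    also have "(\<Prod>t<h. (tl ?e ! (2 * h - 1 - 2 * t) + tl ?e ! (2 * h - 2 - 2 * t)) div m r) =
        (\<Prod>t<h. (?\<alpha> (s + L - 2 * t) r + ?\<alpha> (s + L - 2 * t - 1) r) div m r)"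
    proof (rule prod.cong)
      fix t assume t: "t \<in> {..<h}"
      have tl_nth: "tl ?e ! i = ?e ! Suc i" if "i < 2 * h" for i
        using that len h by (intro nth_tl) simp
      from t have "s + 1 + Suc (2 * h - 1 - 2 * t) = s + L - 2 * t" "s + 1 + Suc (2 * h - 2 - 2 * t) = s + L - 2 * t - 1"
        "Suc (2 * h - 1 - 2 * t) < L" "Suc (2 * h - 2 - 2 * t) < L" "2 * h - 1 - 2 * t < 2 * h" "2 * h - 2 - 2 * t < 2 * h"
        using h by auto
      then show "(tl ?e ! (2 * h - 1 - 2 * t) + tl ?e ! (2 * h - 2 - 2 * t)) div m r =
          (?\<alpha> (s + L - 2 * t) r + ?\<alpha> (s + L - 2 * t - 1) r) div m r"
        by (simp only: nth tl_nth)
    qed simp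
    finally have "carries (m r) (tl ?e) = int (\<Prod>t<h. (?\<alpha> (s + L - 2 * t) r + ?\<alpha> (s + L - 2 * t - 1) r) div m r)" .
    moreover have "hd ?e = ?\<alpha> (s + 1) r"
      using nth[of 0] L len by (simp add: hd_conv_nth)
    moreover have "L div 2 = h" "even (L - 1)" "odd (length ?e)" using h len by simp_all
    ultimately show ?thesis
      using r by (simp only: word_coeff_def cyclic_coeff_def if_False if_True)
        (simp add: R.m_comm)
  qed
  have idx: "s + L - (s + 1) = L - 1" "L - 1 + 1 = L" using L by auto
  have swap: "x \<star> y \<star> z = x \<star> z \<star> y" if "x \<in> RC" "y \<in> RC" "z \<in> RC" for x y z
    using that by (simp add: R.m_ac)
  show ?thesis
    unfolding xi_def idx group_part carry_part group_ring_simps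
    by (rule swap) (use r in auto)
qed

end

context cyclic_decomposition
begin

interpretation R: cring "group_ring G" by (rule group_ring_cring)

text \<open>
  Passing from a pair \<open>(r, \<lambda>)\<close> to its index \<open>a\<close> only adds factors with \<open>a\<^sub>j = 0\<close>. Their blocks are 1 and
  their pairs contribute 0 to the exponent of the sign.
\<close>

lemma comparison_term_coeff:
  assumes l: "r \<in> increasing_tuples l n" "lam \<in> compositions l k" and w: "length w = k"
  shows "gr_int G ((-1) ^ (\<Sum>i\<in>{1..l}. \<Sum>j\<in>{i<..l}. lam i * lam j)) \<star>
      (\<Otimes>\<^bsub>group_ring G\<^esub>u\<in>{1..l}.
        xi G g m (\<lambda>u. expo (w ! (u - 1))) (r u) ((\<Sum>i\<in>{u + 1..l}. lam i) + 1) (\<Sum>i\<in>{u..l}. lam i)) =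
    comparison_coeff n w (place l r lam)"
proof -
  let ?a = "place l r lam"
  have total: "(\<Sum>j\<in>{1..n}. ?a j) = k" using place_koszul[OF l] by blast
  \<comment> \<open>The interval \<open>[a\<^sub>u, b\<^sub>u]\<close> consists of the positions of the segment of factor \<open>r\<^sub>u\<close>.\<close>
  have xi: "xi G g m (\<lambda>u. expo (w ! (u - 1))) (r u) ((\<Sum>i\<in>{u + 1..l}. lam i) + 1) (\<Sum>i\<in>{u..l}. lam i) =
      block n ?a w (r u)" if u: "u \<in> {1..l}" for u
  proof -
    define s where "s = (\<Sum>i\<in>{u + 1..l}. lam i)"
    have "{u..l} = insert u {u + 1..l}" using u by auto
    then have upper: "(\<Sum>i\<in>{u..l}. lam i) = s + lam u" by (simp add: s_def)
    have "{u + 1..l} = {u<..l}" by auto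
    then have above: "(\<Sum>j\<in>{r u<..n}. ?a j) = s"
      using sum_place_above[OF l u] by (simp add: s_def)
    have "lam u \<in> {1..k}" using l u by (auto simp: compositions_def dest: PiE_mem)
    moreover have "s + lam u \<le> k"
    proof -
      have "(\<Sum>i\<in>{u..l}. lam i) \<le> (\<Sum>i\<in>{1..l}. lam i)"
        using u by (intro sum_mono2) auto
      then show ?thesis using upper l(2) by (simp add: compositions_def)
    qed
    ultimately have "xi G g m (\<lambda>u. expo (w ! (u - 1))) (r u) (s + 1) (s + lam u) =
        word_coeff (r u) (take (lam u) (drop s w)) \<star> gr_elem (word_prod (r u - 1) (take (lam u) (drop s w)))"
      using increasing_tuples_range[OF l u] w by (intro xi_segment) auto
    then show ?thesis
      unfolding upper s_def[symmetric] by (simp add: block_def segment_def above place_at[OF l u])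
  qed
  have range: "r ` {1..l} \<subseteq> {1..n}" using increasing_tuples_range[OF l] by auto
  have "(\<Otimes>\<^bsub>group_ring G\<^esub>u\<in>{1..l}.
        xi G g m (\<lambda>u. expo (w ! (u - 1))) (r u) ((\<Sum>i\<in>{u + 1..l}. lam i) + 1) (\<Sum>i\<in>{u..l}. lam i)) =
      (\<Otimes>\<^bsub>group_ring G\<^esub>u\<in>{1..l}. block n ?a w (r u))"
    by (rule R.finprod_cong'[OF refl _ xi]) (use range in auto)
  also have "\<dots> = (\<Otimes>\<^bsub>group_ring G\<^esub>j\<in>r ` {1..l}. block n ?a w j)"
  proof (rule R.finprod_reindex[OF _ increasing_tuples_inj[OF l], symmetric])
    show "block n ?a w \<in> r ` {1..l} \<rightarrow> RC" using range block_closed by (intro Pi_I) (rule block_closed, rule subsetD)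
  qed
  also have "\<dots> = (\<Otimes>\<^bsub>group_ring G\<^esub>j\<in>{1..n}. block n ?a w j)"
  proof (rule R.finprod_mono_neutral_cong_left)
    show "block n ?a w j = \<one>\<^bsub>group_ring G\<^esub>" if "j \<in> {1..n} - r ` {1..l}" for j
    proof -
      have "?a j = 0" using that unfolding place_support[OF l, symmetric] by simp
      then show ?thesis by (simp add: block_empty)
    qed
  qed (use range in auto)
  finally show ?thesis
    using comparison_coeff_closed_form[of n w ?a] total w sum_place_pairs[OF l]
    by (simp add: gr_int_sign_mult Pi_def)
qed

section \<open>The chain map\<close>

text \<open>
  The value of the comparison map on a symbol of the bar resolution, with the separate degree 0 included.
\<close>

definition comparison_symbol :: "nat \<Rightarrow> 'a list \<Rightarrow> ((nat \<Rightarrow> nat) \<Rightarrow>\<^sub>0 ('a \<Rightarrow>\<^sub>0 int))" where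
  "comparison_symbol k w = (if k = 0 then gen G (\<lambda>_. 0)
     else comparison_value G g m n k (\<lambda>u. expo (w ! (u - 1))))"

lemma comparison_map_eq: "comparison_map G g m n k = linear_extension G (comparison_symbol k)"
  unfolding comparison_map_def comparison_symbol_def ..

lemma comparison_value_eq:
  assumes "length w = k"
  shows "comparison_value G g m n k (\<lambda>u. expo (w ! (u - 1))) =
    (\<Sum>l\<in>{1..k}. \<Sum>r\<in>increasing_tuples l n. \<Sum>lam\<in>compositions l k.
      gr_smult G (comparison_coeff n w (place l r lam)) (gen G (place l r lam)))"
  unfolding comparison_value_def using assms
  by (intro sum.cong refl) (simp only: comparison_term_coeff)

lemma comparison_symbol_closed:
  assumes "length w = k"
  shows "comparison_symbol k w \<in> carrier (koszul_module G n k)"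
proof (cases "k = 0")
  case True
  then show ?thesis by (simp add: comparison_symbol_def koszul_module_eq koszul_indices_def)
next
  case False
  have "place l r lam \<in> koszul_indices k" if "r \<in> increasing_tuples l n" "lam \<in> compositions l k" for l r lam
    using place_koszul[OF that] by (simp add: koszul_indices_def)
  then show ?thesis
    using False assms unfolding comparison_symbol_def koszul_module_eq comparison_value_eq[OF assms]
    by (auto intro!: free_gr_module_sum free_gr_module_smult gen_closed)
qed

lemma comparison_coeff_Nil: "comparison_coeff r [] (\<lambda>_. 0) = Poly_Mapping.single \<one> 1"
  by (induction r)
    (simp_all add: word_coeff_def cyclic_coeff_def word_prod_def gr_elem_one gr_int_one)

text \<open>
  Exactly one summand of the comparison formula has the index \<open>a\<close>, given by the support of \<open>a\<close>.
\<close>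

lemma lookup_comparison_symbol:
  assumes w: "length w = k" and a: "a \<in> koszul_indices k"
  shows "Poly_Mapping.lookup (comparison_symbol k w) a = comparison_coeff n w a"
proof (cases "k = 0")
  case True
  have "a i = 0" for i using a True by (cases "i \<in> {1..n}") (auto simp: koszul_indices_def)
  then have "a = (\<lambda>_. 0)" by auto
  then show ?thesis
    using True w by (simp add: comparison_symbol_def gen_def comparison_coeff_Nil)
next
  case False
  have a': "\<forall>i. i \<notin> {1..n} \<longrightarrow> a i = 0" "(\<Sum>i\<in>{1..n}. a i) = k"
    using a unfolding koszul_indices_def by blast+
  have k: "1 \<le> k" using False by simp
  obtain l0 r0 lam0 where wit: "l0 \<in> {1..k}" "r0 \<in> increasing_tuples l0 n" "lam0 \<in> compositions l0 k" "a = place l0 r0 lam0"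
    by (rule place_surj[OF a' k])
  let ?c = "comparison_coeff n w a"
  have term_eq: "Poly_Mapping.lookup (gr_smult G (comparison_coeff n w (place l r lam)) (gen G (place l r lam))) a =
      (if l = l0 then if r = r0 then if lam = lam0 then ?c else 0 else 0 else 0)"
    if "r \<in> increasing_tuples l n" "lam \<in> compositions l k" for l r lam
    using place_inject[OF that(1) wit(2) that(2) wit(3)] wit(4)
    by (cases "place l r lam = a") (auto simp: gen_def lookup_single)
  have "Poly_Mapping.lookup (comparison_symbol k w) a =
      (\<Sum>l\<in>{1..k}. \<Sum>r\<in>increasing_tuples l n. \<Sum>lam\<in>compositions l k.
        if l = l0 then if r = r0 then if lam = lam0 then ?c else 0 else 0 else 0)"
    using False unfolding comparison_symbol_def comparison_value_eq[OF w]
    by (simp only: if_False lookup_sum) (intro sum.cong refl, simp only: term_eq)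
  also have "\<dots> = (\<Sum>l\<in>{1..k}. if l = l0 then \<Sum>r\<in>increasing_tuples l0 n.
      if r = r0 then \<Sum>lam\<in>compositions l0 k. if lam = lam0 then ?c else 0 else 0 else 0)"
    by (intro sum.cong refl) (auto intro!: sum.cong)
  also have "\<dots> = ?c"
    using wit finite_increasing_tuples finite_compositions by simp
  finally show ?thesis .
qed

definition bar_words :: "nat \<Rightarrow> 'a list set" where
  "bar_words k = {hs. length hs = k \<and> set hs \<subseteq> carrier G - {\<one>}}"

lemma bar_module_eq: "bar_module G k = free_gr_module G (bar_words k)"
  by (simp add: bar_module_def bar_words_def)

lemma bar_symbol_closed:
  assumes "length w = k" "set w \<subseteq> carrier G"
  shows "bar_symbol G w \<in> carrier (bar_module G k)"
  using assms by (auto simp: bar_symbol_def bar_module_eq bar_words_def intro!: gen_closed)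

text \<open>
  Words with an identity letter are 0 in the normalized bar resolution. The coefficients vanish on them,
  so the faces of the bar differential can be treated alike, degenerate or not.
\<close>

lemma lookup_comparison_bar_symbol:
  assumes w: "length w = k" "set w \<subseteq> carrier G" and a: "a \<in> koszul_indices k"
  shows "Poly_Mapping.lookup (linear_extension G (comparison_symbol k) (bar_symbol G w)) a = comparison_coeff n w a"
proof (cases "\<one> \<in> set w")
  case True
  then show ?thesis
    using comparison_coeff_zero[of n w a] w a by (simp add: bar_symbol_def koszul_indices_def)
next
  case False
  then show ?thesis
    using comparison_symbol_closed[OF w(1)] lookup_comparison_symbol[OF w(1) a]
    by (simp add: bar_symbol_def linear_extension_gen koszul_module_eq)
qed

definition bar_boundary :: "nat \<Rightarrow> 'a list \<Rightarrow> ('a list \<Rightarrow>\<^sub>0 ('a \<Rightarrow>\<^sub>0 int))" where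
  "bar_boundary k hs = gr_smult G (gr_elem (hs ! 0)) (bar_symbol G (tl hs))
    + (\<Sum>u\<in>{1..k - 1}. gr_smult G (gr_int G ((-1) ^ u)) (bar_symbol G (merge (\<otimes>) u hs)))
    + gr_smult G (gr_int G ((-1) ^ k)) (bar_symbol G (butlast hs))"

lemma bar_diff_eq: "bar_diff G k = linear_extension G (bar_boundary k)"
  unfolding bar_diff_def bar_boundary_def merge_def ..

lemma set_merge_carrier:
  assumes "1 \<le> u" "u < length w" "set w \<subseteq> carrier G"
  shows "set (merge (\<otimes>) u w) \<subseteq> carrier G"
proof -
  have "w ! (u - 1) \<in> carrier G" "w ! u \<in> carrier G"
    using assms by (auto simp: subset_iff)
  then show ?thesis using set_merge[OF assms(1,2), of "(\<otimes>)"] assms(3) by auto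
qed

lemma koszul_diff_eq: "koszul_diff G g m n = linear_extension G (\<lambda>b. \<Sum>i\<in>{1..n}. koszul_diff_part G g m i b)"
  by (simp add: koszul_diff_def)

text \<open>
  It suffices to compare coefficients, where the claim is the boundary identity for \<open>comparison_coeff\<close>
  with all \<open>n\<close> factors.
\<close>

lemma comparison_boundary:
  assumes k: "k \<ge> 1" and w: "w \<in> bar_words k"
  shows "koszul_diff G g m n (comparison_symbol k w) = linear_extension G (comparison_symbol (k - 1)) (bar_boundary k w)"
    and "bar_boundary k w \<in> carrier (bar_module G (k - 1))"
proof -
  let ?L = "linear_extension G (comparison_symbol (k - 1))"
  let ?B = "carrier (free_gr_module G (bar_words (k - 1)))"
  have len: "length w = k" and set: "set w \<subseteq> carrier G" using w by (auto simp: bar_words_def)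
  have "w \<noteq> []" using k len by auto
  then have hd: "w ! 0 = hd w" "hd w \<in> carrier G" using set by (auto simp: hd_conv_nth)
  have tl: "length (tl w) = k - 1" "set (tl w) \<subseteq> carrier G"
    using len set \<open>w \<noteq> []\<close> by (auto dest: list.set_sel(2))
  have butlast: "length (butlast w) = k - 1" "set (butlast w) \<subseteq> carrier G"
    using len set by (auto dest: in_set_butlastD)
  have faces: "length (merge (\<otimes>) u w) = k - 1" "set (merge (\<otimes>) u w) \<subseteq> carrier G" if "u \<in> {1..k - 1}" for u
  proof -
    have u: "1 \<le> u" "u < length w" using that len by auto
    show "length (merge (\<otimes>) u w) = k - 1" "set (merge (\<otimes>) u w) \<subseteq> carrier G"
      using length_merge[OF u, of "(\<otimes>)"] set_merge_carrier[OF u set] len by simp_all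
  qed
  have bar: "bar_symbol G v \<in> ?B" if "length v = k - 1" "set v \<subseteq> carrier G" for v
    using bar_symbol_closed[OF that] by (simp add: bar_module_eq)
  show closed: "bar_boundary k w \<in> carrier (bar_module G (k - 1))"
    unfolding bar_boundary_def bar_module_eq hd(1) using hd(2) tl butlast faces
    by (intro free_gr_module_add free_gr_module_sum free_gr_module_smult bar) simp_all
  have symbol: "comparison_symbol (k - 1) v \<in> carrier (free_gr_module G (koszul_indices (k - 1)))" if "v \<in> bar_words (k - 1)" for v
    using that comparison_symbol_closed[of v "k - 1"] by (simp add: bar_words_def koszul_module_eq)
  have L_closed: "?L (bar_boundary k w) \<in> carrier (free_gr_module G (koszul_indices (k - 1)))"
    using closed symbol unfolding bar_module_eq by (rule linear_extension_closed)
  have K_closed: "koszul_diff G g m n (comparison_symbol k w) \<in> carrier (free_gr_module G (koszul_indices (k - 1)))"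
    unfolding koszul_diff_eq
    using comparison_symbol_closed[OF len] koszul_diff_part_closed unfolding koszul_module_eq
    by (intro linear_extension_closed[where S = "koszul_indices k"] free_gr_module_sum) auto
  have smult: "Poly_Mapping.lookup (?L (gr_smult G x (bar_symbol G v))) a = x \<star> comparison_coeff n v a"
    if "x \<in> RC" "length v = k - 1" "set v \<subseteq> carrier G" "a \<in> koszul_indices (k - 1)" for x v a
    using linear_extension_smult[OF that(1) bar[OF that(2,3)] symbol] lookup_comparison_bar_symbol[OF that(2-4)]
    by simp
  show "koszul_diff G g m n (comparison_symbol k w) = ?L (bar_boundary k w)"
  proof (rule poly_mapping_eqI)
    fix a
    show "Poly_Mapping.lookup (koszul_diff G g m n (comparison_symbol k w)) a = Poly_Mapping.lookup (?L (bar_boundary k w)) a"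
    proof (cases "a \<in> koszul_indices (k - 1)")
      case False
      then show ?thesis
        using free_gr_module_lookup_outside[OF K_closed] free_gr_module_lookup_outside[OF L_closed] by simp
    next
      case True
      then have total: "length w = Suc (\<Sum>j\<in>{1..n}. a j)" using len k by (simp add: koszul_indices_def)
      have up: "a(i := Suc (a i)) \<in> koszul_indices k" if "i \<in> {1..n}" for i
      proof -
        have "(\<Sum>j\<in>{1..n}. (a(i := Suc (a i))) j) = Suc (a i) + (\<Sum>j\<in>{1..n} - {i}. a j)"
          using that by (simp add: sum.remove[of _ i])
        also have "\<dots> = Suc (\<Sum>j\<in>{1..n}. a j)"
          using that by (simp add: sum.remove[of _ i])
        finally show ?thesis
          using True that total len by (auto simp: koszul_indices_def)
      qed
      have "Poly_Mapping.lookup (koszul_diff G g m n (comparison_symbol k w)) a =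
          (\<Sum>i\<in>{1..n}. signed (\<Sum>l\<in>{1..<i}. a l) (cyclic_diff i (Suc (a i)) \<star> comparison_coeff n w (a(i := Suc (a i)))))"
        using comparison_symbol_closed[OF len]
        by (subst lookup_koszul_diff) (auto simp: koszul_module_eq free_gr_module_lookup lookup_comparison_symbol[OF len up] intro!: sum.cong)
      also have "\<dots> = gr_elem (hd w) \<star> comparison_coeff n (tl w) a
          + face_sum (\<otimes>) (\<lambda>v. comparison_coeff n v a) w + signed k (comparison_coeff n (butlast w) a)"
        using comparison_coeff_boundary[OF le_refl set total] hd(2) len by (simp add: word_prod_single)
      also have "\<dots> = Poly_Mapping.lookup (?L (bar_boundary k w)) a"
      proof -
        have "(\<Sum>u\<in>{1..k - 1}. Poly_Mapping.lookup (?L (gr_smult G (gr_int G ((-1) ^ u)) (bar_symbol G (merge (\<otimes>) u w)))) a) =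
            face_sum (\<otimes>) (\<lambda>v. comparison_coeff n v a) w"
          unfolding face_sum_def len
          by (intro sum.cong refl) (simp only: smult[OF gr_int_closed faces True] gr_int_sign_mult comparison_coeff_closed le_refl)
        moreover have "Poly_Mapping.lookup (?L (gr_smult G (gr_elem (hd w)) (bar_symbol G (tl w)))) a =
            gr_elem (hd w) \<star> comparison_coeff n (tl w) a"
          using hd(2) by (intro smult[OF _ tl True]) simp
        moreover have "Poly_Mapping.lookup (?L (gr_smult G (gr_int G ((-1) ^ k)) (bar_symbol G (butlast w)))) a =
            signed k (comparison_coeff n (butlast w) a)"
          by (simp only: smult[OF gr_int_closed butlast True] gr_int_sign_mult comparison_coeff_closed le_refl)
        ultimately show ?thesis
          by (simp only: bar_boundary_def linear_extension_add linear_extension_sum lookup_add lookup_sum hd(1))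
      qed
      finally show ?thesis .
    qed
  qed
qed

lemma comparison_chain_map:
  "chain_map (group_ring G) (bar_module G) (bar_diff G)
     (koszul_module G n) (\<lambda>_. koszul_diff G g m n) (comparison_map G g m n)"
  unfolding chain_map_def
proof (intro conjI allI impI ballI)
  have symbol: "comparison_symbol k w \<in> carrier (free_gr_module G (koszul_indices k))" if "w \<in> bar_words k" for k w
    using that comparison_symbol_closed[of w k] by (simp add: bar_words_def koszul_module_eq)
  show "comparison_map G g m n k \<in> module_homs (group_ring G) (bar_module G k) (koszul_module G n k)" for k
    unfolding comparison_map_eq bar_module_eq koszul_module_eq by (intro linear_extension_hom symbol)
  fix k x assume k: "(1::nat) \<le> k" and x: "x \<in> carrier (bar_module G k)"
  have diff: "(\<Sum>i\<in>{1..n}. koszul_diff_part G g m i b) \<in> carrier (free_gr_module G (koszul_indices (k - 1)))"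
    if "b \<in> koszul_indices k" for b
    using koszul_diff_part_closed[OF _ that] unfolding koszul_module_eq by (intro free_gr_module_sum)
  have "koszul_diff G g m n (comparison_map G g m n k x) =
      linear_extension G (\<lambda>w. koszul_diff G g m n (comparison_symbol k w)) x"
    unfolding comparison_map_eq koszul_diff_eq
    using x unfolding bar_module_eq by (rule linear_extension_compose[OF _ symbol diff])
  also have "\<dots> = linear_extension G (\<lambda>w. linear_extension G (comparison_symbol (k - 1)) (bar_boundary k w)) x"
    unfolding linear_extension_def[of _ _ x]
  proof (intro sum.cong refl)
    fix w assume "w \<in> Poly_Mapping.keys x"
    then have "w \<in> bar_words k" using x by (auto simp: bar_module_eq free_gr_module_carrier)
    then show "gr_smult G (Poly_Mapping.lookup x w) (koszul_diff G g m n (comparison_symbol k w)) =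
        gr_smult G (Poly_Mapping.lookup x w) (linear_extension G (comparison_symbol (k - 1)) (bar_boundary k w))"
      using comparison_boundary(1)[OF k] by simp
  qed
  also have "\<dots> = comparison_map G g m n (k - 1) (bar_diff G k x)"
    unfolding comparison_map_eq bar_diff_eq
    using x comparison_boundary(2)[OF k] unfolding bar_module_eq
    by (rule linear_extension_compose[OF _ _ symbol, symmetric])
  finally show "koszul_diff G g m n (comparison_map G g m n k x) = comparison_map G g m n (k - 1) (bar_diff G k x)" .
qed

lemma comparison_augmentation:
  assumes "x \<in> carrier (bar_module G 0)"
  shows "koszul_augmentation (comparison_map G g m n 0 x) = bar_augmentation x"
proof -
  have "Poly_Mapping.keys x \<subseteq> {[]}" using assms by (auto simp: bar_module_eq free_gr_module_carrier bar_words_def)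
  then have "Poly_Mapping.lookup (comparison_map G g m n 0 x) (\<lambda>_. 0) = Poly_Mapping.lookup x []"
    using assms by (simp add: comparison_map_eq comparison_symbol_def lookup_linear_extension[of "{[]}"] gen_def
        bar_module_eq free_gr_module_lookup)
  then show ?thesis by (simp add: koszul_augmentation_def bar_augmentation_def)
qed

end

section \<open>Products of cyclic groups of residues\<close>

text \<open>
  Every residue is a multiple of the generator; as there are as many multipliers as residues, none
  is repeated.
\<close>

lemma generator_multiples_bij:
  assumes "m \<ge> 1" "generate (integer_mod_group m) {c} = carrier (integer_mod_group m)"
  shows "bij_betw (\<lambda>e. (int e * c) mod int m) {..<m} {0..<int m}"
proof -
  have carrier: "carrier (integer_mod_group m) = {0..<int m}"
    using assms(1) by (simp add: carrier_integer_mod_group)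
  have "c \<in> carrier (integer_mod_group m)"
    using generate.incl[of c "{c}" "integer_mod_group m"] assms(2) by simp
  then have gen: "{0..<int m} = {(k * c) mod int m |k. k \<in> UNIV}"
    using group.generate_pow[of "integer_mod_group m" c] assms(2) carrier
    by (simp add: int_pow_integer_mod_group)
  have surj: "(\<lambda>e. (int e * c) mod int m) ` {..<m} = {0..<int m}"
  proof (intro equalityI subsetI)
    fix x assume "x \<in> {0..<int m}"
    then obtain k where k: "x = (k * c) mod int m" using gen by auto
    have "int (nat (k mod int m)) = k mod int m" using assms(1) by simp
    then have "x = (int (nat (k mod int m)) * c) mod int m"
      using k by (simp add: mod_mult_left_eq)
    moreover have "nat (k mod int m) < m" using assms(1) by (simp add: nat_less_iff)
    ultimately show "x \<in> (\<lambda>e. (int e * c) mod int m) ` {..<m}" by (intro image_eqI lessThan_iff[THEN iffD2])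
  qed (use assms(1) in auto)
  moreover have "inj_on (\<lambda>e. (int e * c) mod int m) {..<m}"
    by (rule eq_card_imp_inj_on) (simp_all add: surj)
  ultimately show ?thesis by (simp add: bij_betw_def)
qed

lemma cyclic_product_decomposition:
  assumes m: "\<And>i. i \<in> {1..n} \<Longrightarrow> m i \<ge> 1"
    and c: "\<And>i. i \<in> {1..n} \<Longrightarrow>
          generate (integer_mod_group (m i)) {c i} = carrier (integer_mod_group (m i))"
  shows "cyclic_decomposition (cyclic_product m n) (\<lambda>i. factor_embedding m n i (c i)) m n"
proof -
  let ?G = "cyclic_product m n" and ?g = "\<lambda>i. factor_embedding m n i (c i)"
  have carrier: "carrier ?G = (\<Pi>\<^sub>E i\<in>{1..n}. {0..<int (m i)})"
    unfolding cyclic_product_def carrier_product_group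
  proof (rule PiE_cong)
    show "carrier (integer_mod_group (m i)) = {0..<int (m i)}" if "i \<in> {1..n}" for i
      using m[OF that] by (simp add: carrier_integer_mod_group)
  qed
  have mult: "x \<otimes>\<^bsub>?G\<^esub> y = (\<lambda>i\<in>{1..n}. (x i + y i) mod int (m i))" for x y
    by (simp add: cyclic_product_def)
  have one: "\<one>\<^bsub>?G\<^esub> = (\<lambda>i\<in>{1..n}. 0)" by (simp add: cyclic_product_def)
  have "group ?G" unfolding cyclic_product_def by (rule product_group) simp
  then interpret comm_group ?G
    by (rule group.group_comm_groupI) (simp add: mult add.commute)
  have c_range: "c i \<in> {0..<int (m i)}" if "i \<in> {1..n}" for i
    using generate.incl[of "c i" "{c i}" "integer_mod_group (m i)"] c[OF that] m[OF that]
    by (simp add: carrier_integer_mod_group)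
  have m_pos: "m i > 0" if "i \<in> {1..n}" for i using m[OF that] by simp
  have closed: "?g i \<in> carrier ?G" if "i \<in> {1..n}" for i
    using that c_range m_pos by (auto simp: carrier factor_embedding_def)
  have pow: "?g i [^]\<^bsub>?G\<^esub> k = (\<lambda>j\<in>{1..n}. if j = i then (int k * c i) mod int (m i) else 0)" if "i \<in> {1..n}" for i and k :: nat
  proof (induction k)
    case (Suc k)
    then show ?case
      by (auto simp: mult factor_embedding_def fun_eq_iff algebra_simps mod_simps)
  qed (auto simp: one fun_eq_iff)
  have prod: "(\<Otimes>\<^bsub>?G\<^esub>j\<in>J. ?g j [^]\<^bsub>?G\<^esub> e j) = (\<lambda>j\<in>{1..n}. if j \<in> J then (int (e j) * c j) mod int (m j) else 0)"
    if "finite J" "J \<subseteq> {1..n}" for J and e :: "nat \<Rightarrow> nat"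
    using that
  proof (induction J)
    case (insert i J)
    have "(\<Otimes>\<^bsub>?G\<^esub>j\<in>insert i J. ?g j [^]\<^bsub>?G\<^esub> e j) = ?g i [^]\<^bsub>?G\<^esub> e i \<otimes>\<^bsub>?G\<^esub> (\<Otimes>\<^bsub>?G\<^esub>j\<in>J. ?g j [^]\<^bsub>?G\<^esub> e j)"
      using insert by (intro finprod_insert) (auto simp: closed subset_iff)
    also have "\<dots> = (\<lambda>j\<in>{1..n}. if j \<in> insert i J then (int (e j) * c j) mod int (m j) else 0)"
      using insert by (auto simp: pow mult fun_eq_iff)
    finally show ?case .
  qed (auto simp: one)
  show ?thesis
  proof
    show "?g i \<in> carrier ?G" if "i \<in> {1..n}" for i using that by (rule closed)
    show "m i > 0" if "i \<in> {1..n}" for i using that by (rule m_pos)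
    show "?g i [^]\<^bsub>?G\<^esub> m i = \<one>\<^bsub>?G\<^esub>" if "i \<in> {1..n}" for i
      using that by (auto simp: pow one fun_eq_iff)
    fix h assume h: "h \<in> carrier ?G"
    have "\<exists>!e. e \<in> {..<m j} \<and> (int e * c j) mod int (m j) = h j" if "j \<in> {1..n}" for j
    proof -
      let ?f = "\<lambda>e. (int e * c j) mod int (m j)"
      have bij: "bij_betw ?f {..<m j} {0..<int (m j)}"
        using m[OF that] c[OF that] by (rule generator_multiples_bij)
      have "h j \<in> ?f ` {..<m j}"
        using h that unfolding carrier bij_betw_imp_surj_on[OF bij] by (rule PiE_mem)
      then obtain e where e: "e \<in> {..<m j}" "h j = ?f e" by (rule imageE)
      show ?thesis
      proof (rule ex1I[of _ e])
        show "e' = e" if "e' \<in> {..<m j} \<and> ?f e' = h j" for e'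
          using that e by (intro inj_onD[OF bij_betw_imp_inj_on[OF bij]]) simp_all
      qed (use e in simp)
    qed
    then obtain f where f: "\<And>j. j \<in> {1..n} \<Longrightarrow> f j \<in> {..<m j} \<and> (int (f j) * c j) mod int (m j) = h j"
      and uniq: "\<And>j e. j \<in> {1..n} \<Longrightarrow> e \<in> {..<m j} \<Longrightarrow> (int e * c j) mod int (m j) = h j \<Longrightarrow> e = f j"
      by metis
    have h_eq: "h = (\<Otimes>\<^bsub>?G\<^esub>j\<in>{1..n}. ?g j [^]\<^bsub>?G\<^esub> e j) \<longleftrightarrow> (\<forall>j\<in>{1..n}. (int (e j) * c j) mod int (m j) = h j)" for e
      using h unfolding carrier prod[OF finite_atLeastAtMost subset_refl]
      by (auto simp: fun_eq_iff PiE_def extensional_def)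
    show "\<exists>!e. e \<in> (\<Pi>\<^sub>E j\<in>{1..n}. {..<m j}) \<and> h = (\<Otimes>\<^bsub>?G\<^esub>j\<in>{1..n}. ?g j [^]\<^bsub>?G\<^esub> e j)"
    proof (rule ex1I[of _ "restrict f {1..n}"])
      show "restrict f {1..n} \<in> (\<Pi>\<^sub>E j\<in>{1..n}. {..<m j}) \<and> h = (\<Otimes>\<^bsub>?G\<^esub>j\<in>{1..n}. ?g j [^]\<^bsub>?G\<^esub> restrict f {1..n} j)"
        unfolding h_eq using f by auto
      show "e = restrict f {1..n}" if "e \<in> (\<Pi>\<^sub>E j\<in>{1..n}. {..<m j}) \<and> h = (\<Otimes>\<^bsub>?G\<^esub>j\<in>{1..n}. ?g j [^]\<^bsub>?G\<^esub> e j)" for e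
      proof (rule PiE_ext[of e "{1..n}" "\<lambda>j. {..<m j}"])
        show "restrict f {1..n} \<in> (\<Pi>\<^sub>E j\<in>{1..n}. {..<m j})" using f by auto
        show "e j = restrict f {1..n} j" if "j \<in> {1..n}" for j
          using that \<open>e \<in> _ \<and> _\<close> uniq[OF that, of "e j"] unfolding h_eq by (auto dest: PiE_mem)
      qed (use that in blast)
    qed
  qed
qed

theorem proposition2p4:
  fixes n :: nat and m :: "nat \<Rightarrow> nat" and c :: "nat \<Rightarrow> int"
    and G :: "(nat \<Rightarrow> int) monoid" and g :: "nat \<Rightarrow> (nat \<Rightarrow> int)"
  assumes "\<And>i. i \<in> {1..n} \<Longrightarrow> m i \<ge> 1"
    and "\<And>i. i \<in> {1..<n} \<Longrightarrow> m i dvd m (i + 1)"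
    and "\<And>i. i \<in> {1..n} \<Longrightarrow>
          generate (integer_mod_group (m i)) {c i} = carrier (integer_mod_group (m i))"
    and "G = cyclic_product m n"
    and "g = (\<lambda>i. factor_embedding m n i (c i))"
  shows "chain_map (group_ring G) (bar_module G) (bar_diff G)
           (koszul_module G n) (\<lambda>_. koszul_diff G g m n) (comparison_map G g m n) \<and>
         (\<forall>x\<in>carrier (bar_module G 0).
           koszul_augmentation (comparison_map G g m n 0 x) = bar_augmentation x)"
proof -
  interpret cyclic_decomposition G g m n
    unfolding assms(4,5) using assms(1,3) by (rule cyclic_product_decomposition)
  show ?thesis using comparison_chain_map comparison_augmentation by blast
qed

end
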